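(* Let $d\ge2$ be an integer, $1\le p\le2$, $\eta>0$, and let $f\in L^p(\mathbb{T}^d)$. Assume that there is a constant $A(f)$ (depending on $f$ but not on $\delta$) such that $$\omega(\delta,f)_p\le \frac{A(f)}{(\log(1/\delta))^{d/p}\,(\log\log(e^e/\delta))^{1+\eta}},\qquad 0<\delta\le\tfrac12 .$$ Then $S_{\mathbf{n}}f(x)\to f(x)$ almost everywhere in the sense of Pringsheim; that is, for almost every $x\in\mathbb{T}^d$, $S_{\mathbf{n}}f(x)\to f(x)$ as $\min_{1\le j\le d}n_j\to\infty$.
   Context: $\mathbb{T}=\mathbb{R}/(2\pi\mathbb{Z})$, and $\mathbb{T}^d$ carries the normalized Haar measure $dm_d(x)=(2\pi)^{-d}dx$; $\|\cdot\|_p$ is the norm of $L^p(\mathbb{T}^d)$ with respect to $m_d$. For $t\in\mathbb{T}$, $|t|_{\mathbb{T}}=\operatorname{dist}(t,2\pi\mathbb{Z})\in[0,\pi]$, and for $h=(h_1,\dots,h_d)\in\mathbb{T}^d$, $\|h\|_{\mathbb{T}^d}=\max_{1\le j\le d}|h_j|_{\mathbb{T}}$. The $L^p$ modulus of continuity is $\omega(\delta,f)_p=\sup_{\|h\|_{\mathbb{T}^d}\le\delta}\|f(\cdot+h)-f(\cdot)\|_p$ for $\delta>0$. Fourier coefficients: $\widehat f(\mathbf{k})=\int_{\mathbb{T}^d}f(x)e^{-i\mathbf{k}\cdot x}\,dm_d(x)$, $\mathbf{k}\in\mathbb{Z}^d$. For $\mathbf{n}=(n_1,\dots,n_d)\in\mathbb{N}_0^d$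 the symmetric rectangular partial sum is $$S_{\mathbf{n}}f(x)=\sum_{|k_1|\le n_1}\cdots\sum_{|k_d|\le n_d}\widehat f(\mathbf{k})e^{i\mathbf{k}\cdot x}.$$ All logarithms are natural. *)

theory Defs
  imports "HOL-Analysis.Analysis"
begin

text \<open>
  Functions on \<open>\<T>\<^sup>d\<close> are represented by functions on \<open>\<real>\<^sup>d\<close> (type \<open>real ^ 'd\<close>, with
  \<open>d = CARD('d)\<close>) that are invariant under translations by \<open>2\<pi>\<int>\<^sup>d\<close>; points and translation
  vectors of \<open>\<T>\<^sup>d\<close> are represented by arbitrary lifts to \<open>\<real>\<^sup>d\<close>.
\<close>

definition torus_periodic :: "(real ^ 'd \<Rightarrow> 'a) \<Rightarrow> bool" where
  "torus_periodic f \<longleftrightarrow> (\<forall>x (k :: int ^ 'd). f (\<chi> j. x $ j + 2 * pi * of_int (k $ j)) = f x)"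

definition torus_cube :: "(real ^ 'd) set" where
  "torus_cube = {x. \<forall>j. 0 \<le> x $ j \<and> x $ j < 2 * pi}"

text \<open>
  The normalized Haar measure, carried by a fundamental domain. The underlying sigma-algebra is
  that of all Lebesgue measurable subsets of \<open>\<real>\<^sup>d\<close>; the complement of the cube is a null set.
\<close>

definition torus_measure :: "(real ^ 'd) measure" where
  "torus_measure =
     density lebesgue (\<lambda>x. ennreal (1 / (2 * pi) ^ CARD('d)) * indicator torus_cube x)"

text \<open>Membership in \<open>L\<^sup>p(\<T>\<^sup>d)\<close> of a (periodic, everywhere defined) representative, \<open>1 \<le> p < \<infinity>\<close>.\<close>

definition torus_Lp :: "real \<Rightarrow> (real ^ 'd \<Rightarrow> complex) set" where
  "torus_Lp p = {f. torus_periodic f \<and> f \<in> borel_measurable lebesgue \<and>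
                    integrable torus_measure (\<lambda>x. norm (f x) powr p)}"

definition Lp_norm :: "real \<Rightarrow> (real ^ 'd \<Rightarrow> complex) \<Rightarrow> real" where
  "Lp_norm p f = (\<integral>x. norm (f x) powr p \<partial>torus_measure) powr (1 / p)"

definition torus_abs :: "real \<Rightarrow> real" where
  "torus_abs t = infdist t (range (\<lambda>k :: int. 2 * pi * of_int k))"

definition torus_norm :: "real ^ 'd \<Rightarrow> real" where
  "torus_norm h = Max (range (\<lambda>j. torus_abs (h $ j)))"

text \<open>
  A supremum of reals: for \<open>f\<close> in \<open>L\<^sup>p\<close> with \<open>p \<ge> 1\<close> the set is nonempty and bounded above by
  twice the norm of \<open>f\<close>, so the value is the genuine supremum.
\<close>

definition modulus_of_continuity :: "real \<Rightarrow> real \<Rightarrow> (real ^ 'd \<Rightarrow> complex) \<Rightarrow> real" where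
  "modulus_of_continuity p \<delta> f =
     (SUP h \<in> {h. torus_norm h \<le> \<delta>}. Lp_norm p (\<lambda>x. f (x + h) - f x))"

definition freq_dot :: "int ^ 'd \<Rightarrow> real ^ 'd \<Rightarrow> real" where
  "freq_dot k x = (\<Sum>j\<in>UNIV. of_int (k $ j) * x $ j)"

definition fourier_coeff :: "(real ^ 'd \<Rightarrow> complex) \<Rightarrow> int ^ 'd \<Rightarrow> complex" where
  "fourier_coeff f k =
     (\<integral>x. f x * exp (- (\<i> * complex_of_real (freq_dot k x))) \<partial>torus_measure)"

definition rect_partial_sum ::
  "nat ^ 'd \<Rightarrow> (real ^ 'd \<Rightarrow> complex) \<Rightarrow> real ^ 'd \<Rightarrow> complex" where
  "rect_partial_sum n f x =
     (\<Sum>k \<in> {k. \<forall>j. \<bar>k $ j\<bar> \<le> int (n $ j)}.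
        fourier_coeff f k * exp (\<i> * complex_of_real (freq_dot k x)))"

text \<open>The index set of the partial sums is finite, so the sum is not a degenerate one.\<close>

lemma finite_rect_index_set: "finite {k :: int ^ 'd. \<forall>j. \<bar>k $ j\<bar> \<le> int (n $ j)}"
proof (rule finite_subset)
  show "{k :: int ^ 'd. \<forall>j. \<bar>k $ j\<bar> \<le> int (n $ j)}
          \<subseteq> vec_lambda ` (\<Pi>\<^sub>E j\<in>UNIV. {- int (n $ j)..int (n $ j)})"
  proof
    fix k :: "int ^ 'd" assume k: "k \<in> {k. \<forall>j. \<bar>k $ j\<bar> \<le> int (n $ j)}"
    have "vec_nth k \<in> (\<Pi>\<^sub>E j\<in>UNIV. {- int (n $ j)..int (n $ j)})"
      using k by (simp add: PiE_UNIV_domain abs_le_iff minus_le_iff)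
    then show "k \<in> vec_lambda ` (\<Pi>\<^sub>E j\<in>UNIV. {- int (n $ j)..int (n $ j)})"
      by (metis imageI vec_nth_inverse)
  qed
qed (simp add: finite_PiE)

definition pringsheim :: "(nat ^ 'd) filter" where
  "pringsheim = filtercomap (\<lambda>n. Min (range (\<lambda>j. n $ j))) at_top"

end

theory Submission
  imports Defs "HOL-Probability.Probability" "HOL-Real_Asymp.Real_Asymp"
begin

text \<open>
  For \<open>L = (log N)\<^sup>d\<close> the maximal operator \<open>max |S\<^sub>n f|\<close> over \<open>n\<^sub>1, \<dots>, n\<^sub>d \<le> N\<close> is
  bounded from \<open>L\<^sup>1\<close> to \<open>L\<^sup>1\<close> with constant of order \<open>L\<close> (the \<open>L\<^sup>1\<close> norm of the maximal
  Dirichlet kernel), and from \<open>L\<^sup>2\<close> to \<open>L\<^sup>1\<close> with constant of order \<open>L\<close> to the power \<open>1/2\<close>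
  (Kolmogorov--Seliverstov--Plessner). Truncating \<open>f\<close> at a suitable height interpolates
  these to \<open>L\<close> to the power \<open>1/p\<close> from \<open>L\<^sup>p\<close> to \<open>L\<^sup>1\<close>. Now write \<open>f\<close> as a telescoping series of
  differences of Fejer means of doubly exponential orders \<open>M\<^sub>j\<close>. The \<open>j\<close>-th difference has degree
  at most \<open>M\<close> at index \<open>j + 1\<close>, so all its partial sums are controlled by one such maximal
  operator, while its \<open>L\<^sup>p\<close> norm is bounded by the modulus of continuity at scale \<open>1 / 2^2^j\<close>.
  The hypothesis makes the resulting bounds \<open>O(j\<close> to the power \<open>-1-\<eta>)\<close>, hence summable, and almost
  everywhere convergence follows.
\<close>

section \<open>Integration on the torus\<close>

text \<open>The growth of \<open>M j\<close> is forced by the hypothesis. If the logarithm of the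
  degree doubles from block to block, passing to the next degree changes \<open>kernel_const\<close>
  by a bounded factor only, the power d/p of log(1/\<delta>) in the modulus cancels the bound of the
  maximal operator in every block, and the iterated logarithm is comparable with j. Along a
  geometric sequence log M would grow like j, the same cancellation would leave only (log
  j)^(-1-\<eta>), and the resulting series would diverge. The bound of the maximal operator grows
  with N, so no density argument is available and every block must be paid for by smoothness. Bounds
  into L1 suffice, since all that is wanted is that a sum of maximal functions be finite almost
  everywhere. Fejer means serve because a positive kernel of mass one turns the modulus into an Lp
  error by Jensen's inequality, and because large rectangles reproduce them. A difference of two
  means is estimated as a difference of two remainders of \<open>f\<close>; the same bound then
  covers the last remainder of the chain, which is not a polynomial.\<close>

text \<open>
  Borel functions and a measure on the Borel sets are used throughout, since the joint measurability
  needed for Fubini's theorem fails to be automatic for Lebesgue measurable functions.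
\<close>

definition torus_borel :: "(real ^ 'd) measure" where
  "torus_borel =
     density lborel (\<lambda>x. ennreal (1 / (2 * pi) ^ CARD('d)) * indicator torus_cube x)"

definition lattice_vec :: "int ^ 'd \<Rightarrow> real ^ 'd" where
  "lattice_vec k = (\<chi> j. 2 * pi * of_int (k $ j))"

definition cell_index :: "real ^ 'd \<Rightarrow> int ^ 'd" where
  "cell_index x = (\<chi> j. \<lfloor>x $ j / (2 * pi)\<rfloor>)"

definition torus_red :: "real ^ 'd \<Rightarrow> real ^ 'd" where
  "torus_red x = x - lattice_vec (cell_index x)"

lemma torus_periodic_iff:
  fixes f :: "real ^ 'd \<Rightarrow> 'a"
  shows "torus_periodic f \<longleftrightarrow> (\<forall>x k. f (x + lattice_vec k) = f x)"
proof -
  have "(\<chi> j. x $ j + 2 * pi * of_int (k $ j)) = x + lattice_vec k" for x :: "real ^ 'd" and k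
    by (simp add: vec_eq_iff lattice_vec_def)
  then show ?thesis by (simp add: torus_periodic_def)
qed

lemma torus_periodicD: "torus_periodic f \<Longrightarrow> f (x + lattice_vec k) = f x"
  by (simp add: torus_periodic_iff)

lemma torus_periodic_minus: "torus_periodic f \<Longrightarrow> f (x - lattice_vec k) = f x"
  using torus_periodicD[of f "x - lattice_vec k" k] by simp

lemma torus_periodic_red: "torus_periodic f \<Longrightarrow> f (torus_red x) = f x"
  by (simp add: torus_red_def torus_periodic_minus)

text \<open>Half-openness makes the cube meet every lattice coset exactly once, with no exceptional
  null set, so the sums over lattice translates below are identically one.\<close>

lemma diff_lattice_vec_in_cube_iff: "x - lattice_vec k \<in> torus_cube \<longleftrightarrow> k = cell_index x"
proof -
  have "(0 \<le> x $ j - 2 * pi * of_int (k $ j) \<and> x $ j - 2 * pi * of_int (k $ j) < 2 * pi)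
        \<longleftrightarrow> k $ j = \<lfloor>x $ j / (2 * pi)\<rfloor>" for j
    by (subst eq_commute, subst floor_eq_iff) (auto simp: field_simps)
  then show ?thesis
    by (simp add: torus_cube_def cell_index_def lattice_vec_def vec_eq_iff)
qed

lemma torus_red_eq: "x \<in> torus_cube \<Longrightarrow> torus_red x = x"
  using diff_lattice_vec_in_cube_iff[of x 0]
  by (simp add: torus_red_def) (simp add: lattice_vec_def zero_vec_def[symmetric])

lemma torus_red_add_lattice_vec: "torus_red (x + lattice_vec k) = torus_red x"
proof -
  have "cell_index (x + lattice_vec k) = cell_index x + k"
    by (simp add: cell_index_def lattice_vec_def vec_eq_iff add_divide_distrib)
  moreover have "lattice_vec (cell_index x + k) = lattice_vec (cell_index x) + lattice_vec k"
    by (simp add: lattice_vec_def vec_eq_iff algebra_simps)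
  ultimately show ?thesis by (simp add: torus_red_def)
qed

lemma torus_periodic_comp_red: "torus_periodic (\<lambda>x. f (torus_red x))"
  by (simp add: torus_periodic_iff torus_red_add_lattice_vec)

lemma borel_measurable_vecI:
  fixes f :: "'a \<Rightarrow> real ^ 'd"
  assumes "\<And>j. (\<lambda>x. f x $ j) \<in> borel_measurable M"
  shows "f \<in> borel_measurable M"
  using assms
  by (subst borel_measurable_euclidean_space) (auto simp: Basis_vec_def inner_axis)

lemma measurable_torus_cube [measurable]: "torus_cube \<in> sets borel"
proof -
  have "torus_cube = {x \<in> space borel. \<forall>j. 0 \<le> x $ j \<and> x $ j < 2 * pi}"
    by (auto simp: torus_cube_def)
  also have "\<dots> \<in> sets borel" by measurable
  finally show ?thesis .
qed

lemma measurable_torus_red [measurable]: "torus_red \<in> borel_measurable borel"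
  by (rule borel_measurable_vecI)
     (simp add: torus_red_def lattice_vec_def cell_index_def)

lemma sets_torus_borel [measurable_cong, simp]: "sets torus_borel = sets borel"
  and space_torus_borel [simp]: "space torus_borel = UNIV"
  by (simp_all add: torus_borel_def)

lemma nn_integral_torus_borel:
  "f \<in> borel_measurable borel \<Longrightarrow>
    (\<integral>\<^sup>+x. f x \<partial>torus_borel) =
      (\<integral>\<^sup>+x. ennreal (1 / (2 * pi) ^ CARD('d)) * indicator torus_cube (x :: real ^ 'd) * f x \<partial>lborel)"
  unfolding torus_borel_def by (subst nn_integral_density) auto

text \<open>The usual unfolding: the indicators of the translated cubes sum to one, so an integral
  over the cube shifted by \<open>h\<close> can be cut along lattice cells, each piece moved back by
  periodicity, and the pieces reassembled. Nonnegativity allows the sum over \<open>k\<close> and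
  the integral to be exchanged.\<close>

lemma nn_integral_torus_shift:
  fixes F :: "real ^ 'd \<Rightarrow> ennreal"
  assumes [measurable]: "F \<in> borel_measurable borel" and per: "torus_periodic F"
  shows "(\<integral>\<^sup>+x. F (x + h) \<partial>torus_borel) = (\<integral>\<^sup>+x. F x \<partial>torus_borel)"
proof -
  let ?c = "ennreal (1 / (2 * pi) ^ CARD('d))"
  have shift: "(\<integral>\<^sup>+x. G (x + a) \<partial>lborel) = (\<integral>\<^sup>+x. G x \<partial>lborel)"
    if [measurable]: "G \<in> borel_measurable borel" for G :: "real ^ 'd \<Rightarrow> ennreal" and a
    by (subst (2) lborel_distr_plus[of a, symmetric])
       (simp add: nn_integral_distr add.commute)
  have one: "(\<integral>\<^sup>+k. indicator torus_cube (x - lattice_vec k) \<partial>count_space UNIV) = (1::ennreal)"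
    for x :: "real ^ 'd"
  proof -
    have "(\<integral>\<^sup>+k. indicator torus_cube (x - lattice_vec k) \<partial>count_space UNIV)
      = (\<integral>\<^sup>+k. indicator {cell_index x} k \<partial>count_space UNIV)"
      by (intro nn_integral_cong) (auto simp: indicator_def diff_lattice_vec_in_cube_iff)
    then show ?thesis by simp
  qed
  have one_plus: "(\<integral>\<^sup>+k. indicator torus_cube (x + lattice_vec k) \<partial>count_space UNIV) = (1::ennreal)"
    for x :: "real ^ 'd"
  proof -
    have "lattice_vec (- k) = - lattice_vec k" for k :: "int ^ 'd"
      by (simp add: lattice_vec_def vec_eq_iff)
    then have "(x + lattice_vec k \<in> torus_cube) = (k = - cell_index x)" for k :: "int ^ 'd"
      using diff_lattice_vec_in_cube_iff[of x "- k"] by (metis diff_minus_eq_add minus_minus)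
    then have "(\<integral>\<^sup>+k. indicator torus_cube (x + lattice_vec k) \<partial>count_space UNIV)
      = (\<integral>\<^sup>+k. indicator {- cell_index x} k \<partial>count_space UNIV)"
      by (intro nn_integral_cong) (auto simp: indicator_def)
    then show ?thesis by simp
  qed
  have swap: "(\<integral>\<^sup>+x. G x \<partial>lborel) =
     (\<integral>\<^sup>+k. (\<integral>\<^sup>+x. indicator torus_cube (x - lattice_vec k) * G x \<partial>lborel) \<partial>count_space (UNIV :: (int ^ 'd) set))"
    if [measurable]: "G \<in> borel_measurable borel" for G :: "real ^ 'd \<Rightarrow> ennreal"
  proof -
    have "(\<integral>\<^sup>+k. (\<integral>\<^sup>+x. indicator torus_cube (x - lattice_vec k) * G x \<partial>lborel) \<partial>count_space (UNIV :: (int ^ 'd) set))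
      = (\<integral>\<^sup>+x. (\<integral>\<^sup>+k. indicator torus_cube (x - lattice_vec k) * G x \<partial>count_space UNIV) \<partial>lborel)"
      by (rule nn_integral_count_space_nn_integral[symmetric]) auto
    then show ?thesis by (simp add: nn_integral_multc one)
  qed
  have "(\<integral>\<^sup>+x. F (x + h) \<partial>torus_borel)
      = (\<integral>\<^sup>+x. ?c * indicator torus_cube x * F (x + h) \<partial>lborel)"
    by (rule nn_integral_torus_borel) simp
  also have "\<dots> = (\<integral>\<^sup>+x. ?c * indicator torus_cube (x - h) * F x \<partial>lborel)"
    by (subst shift[of "\<lambda>x. ?c * indicator torus_cube (x - h) * F x" h, symmetric]) auto
  also have "\<dots> = (\<integral>\<^sup>+k. (\<integral>\<^sup>+x. indicator torus_cube (x - lattice_vec k) *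
        (?c * indicator torus_cube (x - h) * F x) \<partial>lborel) \<partial>count_space UNIV)"
    by (rule swap) simp
  also have "\<dots> = (\<integral>\<^sup>+k. (\<integral>\<^sup>+x. indicator torus_cube x *
        (?c * indicator torus_cube (x - h + lattice_vec k) * F x) \<partial>lborel) \<partial>count_space UNIV)"
  proof (rule nn_integral_cong)
    fix k :: "int ^ 'd"
    show "(\<integral>\<^sup>+x. indicator torus_cube (x - lattice_vec k) *
        (?c * indicator torus_cube (x - h) * F x) \<partial>lborel)
      = (\<integral>\<^sup>+x. indicator torus_cube x *
        (?c * indicator torus_cube (x - h + lattice_vec k) * F x) \<partial>lborel)"
      by (subst shift[of _ "lattice_vec k", symmetric])
         (simp_all add: torus_periodicD[OF per] algebra_simps)
  qed
  also have "\<dots> = (\<integral>\<^sup>+x. (\<integral>\<^sup>+k. indicator torus_cube x *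
        (?c * indicator torus_cube (x - h + lattice_vec k) * F x) \<partial>count_space UNIV) \<partial>lborel)"
    by (rule nn_integral_count_space_nn_integral[symmetric]) auto
  also have "\<dots> = (\<integral>\<^sup>+x. ?c * indicator torus_cube x * F x \<partial>lborel)"
  proof (rule nn_integral_cong)
    fix x :: "real ^ 'd"
    have "(\<integral>\<^sup>+k. indicator torus_cube x *
        (?c * indicator torus_cube (x - h + lattice_vec k) * F x) \<partial>count_space UNIV)
      = (\<integral>\<^sup>+k. (?c * indicator torus_cube x * F x) *
           indicator torus_cube (x - h + lattice_vec k) \<partial>count_space UNIV)"
      by (simp add: mult_ac)
    then show "(\<integral>\<^sup>+k. indicator torus_cube x *
        (?c * indicator torus_cube (x - h + lattice_vec k) * F x) \<partial>count_space UNIV)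
        = ?c * indicator torus_cube x * F x"
      by (simp add: nn_integral_cmult one_plus)
  qed
  also have "\<dots> = (\<integral>\<^sup>+x. F x \<partial>torus_borel)"
    by (rule nn_integral_torus_borel[symmetric]) simp
  finally show ?thesis .
qed

text \<open>Invariance is recast as a statement about an image measure because it then passes to
  Bochner integrals without splitting functions into nonnegative parts. Reduction is composed with
  the translation since a translation alone leaves the cube.\<close>

lemma distr_torus_borel:
  fixes h :: "real ^ 'd"
  shows "distr torus_borel borel (\<lambda>x. torus_red (x + h)) = torus_borel"
proof (rule measure_eqI)
  fix A :: "(real ^ 'd) set" assume "A \<in> sets (distr torus_borel borel (\<lambda>x. torus_red (x + h)))"
  then have [measurable]: "A \<in> sets borel" by simp
  have "emeasure (distr torus_borel borel (\<lambda>x. torus_red (x + h))) A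
      = (\<integral>\<^sup>+x. indicator A (torus_red (x + h)) \<partial>torus_borel)"
    by (subst nn_integral_indicator[symmetric], simp, subst nn_integral_distr) auto
  also have "\<dots> = (\<integral>\<^sup>+x. indicator A (torus_red x) \<partial>torus_borel)"
    by (rule nn_integral_torus_shift[where F = "\<lambda>x. indicator A (torus_red x)"])
       (auto intro: torus_periodic_comp_red)
  also have "\<dots> = (\<integral>\<^sup>+x. indicator A x \<partial>torus_borel)"
    by (subst (1 2) nn_integral_torus_borel)
       (auto intro!: nn_integral_cong simp: torus_red_eq split: split_indicator)
  finally show "emeasure (distr torus_borel borel (\<lambda>x. torus_red (x + h))) A = emeasure torus_borel A"
    by simp
qed simp

lemma
  fixes F :: "real ^ 'd \<Rightarrow> 'b :: {banach, second_countable_topology}"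
  assumes [measurable]: "F \<in> borel_measurable borel" and "torus_periodic F"
  shows integral_torus_shift: "(\<integral>x. F (x + h) \<partial>torus_borel) = (\<integral>x. F x \<partial>torus_borel)"
    and integrable_torus_shift_iff:
      "integrable torus_borel (\<lambda>x. F (x + h)) \<longleftrightarrow> integrable torus_borel F"
proof -
  show "(\<integral>x. F (x + h) \<partial>torus_borel) = (\<integral>x. F x \<partial>torus_borel)"
    by (subst distr_torus_borel[of h, symmetric], subst integral_distr)
       (simp_all add: torus_periodic_red assms(2))
  show "integrable torus_borel (\<lambda>x. F (x + h)) \<longleftrightarrow> integrable torus_borel F"
    by (subst (2) distr_torus_borel[of h, symmetric], subst integrable_distr_eq)
       (simp_all add: torus_periodic_red assms(2))
qed

section \<open>Product structure of the measure and reduction to one variable\<close>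

definition circle_borel :: "real measure" where
  "circle_borel = density lborel (\<lambda>t. ennreal (1 / (2 * pi)) * indicator {0..<2 * pi} t)"

lemma sets_circle_borel [measurable_cong, simp]: "sets circle_borel = sets borel"
  and space_circle_borel [simp]: "space circle_borel = UNIV"
  by (simp_all add: circle_borel_def)

text \<open>\<open>lborel\<close> is built from the Euclidean basis, whereas the product theorem for
  nonnegative integrals speaks of \<open>Pi\<^sub>M\<close> over an index type. Agreement on boxes
  identifies the two.\<close>

lemma lborel_vec_eq_distr:
  "(lborel :: (real ^ 'd) measure) = distr (Pi\<^sub>M UNIV (\<lambda>_. lborel)) borel vec_lambda"
proof (rule lborel_eqI)
  interpret product_sigma_finite "\<lambda>_ :: 'd. lborel :: real measure" ..
  have [measurable]: "vec_lambda \<in> Pi\<^sub>M UNIV (\<lambda>_. lborel) \<rightarrow>\<^sub>M (borel :: (real ^ 'd) measure)"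
    by (rule borel_measurable_vecI) simp
  fix l u :: "real ^ 'd" assume le: "\<And>b. b \<in> Basis \<Longrightarrow> l \<bullet> b \<le> u \<bullet> b"
  have le': "l $ j \<le> u $ j" for j
    using le[of "axis j 1"] by (simp add: inner_axis axis_in_Basis_iff)
  have "emeasure (distr (Pi\<^sub>M UNIV (\<lambda>_. lborel)) borel vec_lambda) (box l u)
      = emeasure (Pi\<^sub>M UNIV (\<lambda>_. lborel)) (Pi\<^sub>E UNIV (\<lambda>j. {l $ j<..<u $ j}))"
    by (subst emeasure_distr)
       (auto intro!: arg_cong[where f = "emeasure _"] simp: space_PiM PiE_UNIV_domain mem_box_cart Pi_iff)
  also have "\<dots> = (\<Prod>j\<in>UNIV. ennreal (u $ j - l $ j))"
    by (subst emeasure_PiM) (auto simp: le')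
  also have "\<dots> = ennreal (\<Prod>b\<in>Basis. (u - l) \<bullet> b)"
  proof -
    have B: "(Basis :: (real ^ 'd) set) = range (\<lambda>j. axis j 1)"
      by (auto simp: Basis_vec_def)
    have "inj (\<lambda>j :: 'd. axis j (1 :: real))"
      by (auto simp: inj_on_def axis_eq_axis)
    then have "(\<Prod>b\<in>Basis. (u - l) \<bullet> b) = (\<Prod>j\<in>UNIV. u $ j - l $ j)"
      unfolding B by (subst prod.reindex) (simp_all add: inner_axis)
    then show ?thesis
      by (simp add: prod_ennreal le')
  qed
  finally show "emeasure (distr (Pi\<^sub>M UNIV (\<lambda>_. lborel)) borel vec_lambda) (box l u)
     = ennreal (\<Prod>b\<in>Basis. (u - l) \<bullet> b)" .
qed simp

lemma nn_integral_torus_prod: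
  fixes \<phi> :: "'d :: finite \<Rightarrow> real \<Rightarrow> ennreal"
  assumes [measurable]: "\<And>j. \<phi> j \<in> borel_measurable borel"
  shows "(\<integral>\<^sup>+x. (\<Prod>j\<in>UNIV. \<phi> j (x $ j)) \<partial>torus_borel) = (\<Prod>j\<in>UNIV. \<integral>\<^sup>+t. \<phi> j t \<partial>circle_borel)"
proof -
  interpret product_sigma_finite "\<lambda>_ :: 'd. lborel :: real measure" ..
  have [measurable]: "vec_lambda \<in> Pi\<^sub>M UNIV (\<lambda>_. lborel) \<rightarrow>\<^sub>M (borel :: (real ^ 'd) measure)"
    by (rule borel_measurable_vecI) simp
  have [measurable]: "(\<lambda>x :: real ^ 'd. \<phi> j (x $ j)) \<in> borel_measurable borel" for j
    by (rule measurable_compose[OF borel_measurable_nth assms])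
  let ?g = "\<lambda>j t. ennreal (1 / (2 * pi)) * indicator {0..<2 * pi} t * \<phi> j t"
  have ind: "(indicator torus_cube x :: ennreal) = (\<Prod>j\<in>UNIV. indicator {0..<2 * pi} (x $ j))"
    for x :: "real ^ 'd"
    by (auto simp: torus_cube_def indicator_def)
  have cst: "ennreal (1 / (2 * pi) ^ CARD('d)) = (\<Prod>j\<in>(UNIV :: 'd set). ennreal (1 / (2 * pi)))"
    by (simp add: ennreal_power power_one_over)
  have "(\<integral>\<^sup>+x. (\<Prod>j\<in>UNIV. \<phi> j (x $ j)) \<partial>torus_borel)
      = (\<integral>\<^sup>+x. (\<Prod>j\<in>UNIV. ?g j (x $ j)) \<partial>lborel)"
    by (subst nn_integral_torus_borel, measurable) (simp only: ind cst prod.distrib)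
  also have "\<dots> = (\<integral>\<^sup>+y. (\<Prod>j\<in>UNIV. ?g j (y j)) \<partial>Pi\<^sub>M UNIV (\<lambda>_. lborel))"
    by (subst lborel_vec_eq_distr, subst nn_integral_distr) auto
  also have "\<dots> = (\<Prod>j\<in>UNIV. \<integral>\<^sup>+t. ?g j t \<partial>lborel)"
    by (rule product_nn_integral_prod) auto
  also have "\<dots> = (\<Prod>j\<in>UNIV. \<integral>\<^sup>+t. \<phi> j t \<partial>circle_borel)"
    by (simp add: circle_borel_def nn_integral_density)
  finally show ?thesis .
qed

lemma emeasure_circle_borel_UNIV: "emeasure circle_borel UNIV = 1"
proof -
  have "emeasure circle_borel UNIV = (\<integral>\<^sup>+t. 1 \<partial>circle_borel)"
    by (simp add: circle_borel_def)
  also have "\<dots> = 1"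
    unfolding circle_borel_def
    by (subst nn_integral_density) (simp_all add: nn_integral_cmult flip: ennreal_mult)
  finally show ?thesis .
qed

lemma prob_space_torus_borel: "prob_space (torus_borel :: (real ^ 'd) measure)"
proof
  have "(\<integral>\<^sup>+x. 1 \<partial>(torus_borel :: (real ^ 'd) measure)) = 1"
    using nn_integral_torus_prod[of "\<lambda>_ :: 'd. \<lambda>_. 1"] emeasure_circle_borel_UNIV by simp
  then show "emeasure (torus_borel :: (real ^ 'd) measure) (space torus_borel) = 1" by simp
qed

section \<open>Transfer between the Lebesgue and the Borel version of the measure\<close>

lemma integral_torus_measure:
  fixes F :: "real ^ 'd \<Rightarrow> 'b :: {banach, second_countable_topology}"
  assumes [measurable]: "F \<in> borel_measurable borel"
  shows "integral\<^sup>L torus_measure F = integral\<^sup>L torus_borel F"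
proof -
  let ?w = "\<lambda>x :: real ^ 'd. (1 / (2 * pi) ^ CARD('d)) * indicator torus_cube x"
  have w: "(\<lambda>x :: real ^ 'd. ennreal (1 / (2 * pi) ^ CARD('d)) * indicator torus_cube x) = (\<lambda>x. ennreal (?w x))"
    by (auto simp: fun_eq_iff split: split_indicator)
  have "F \<in> borel_measurable lebesgue" "?w \<in> borel_measurable lebesgue"
    by (auto intro!: measurable_completion)
  then have "integral\<^sup>L torus_measure F = (\<integral>x. ?w x *\<^sub>R F x \<partial>lebesgue)"
    unfolding torus_measure_def w by (intro integral_density) auto
  also have "\<dots> = (\<integral>x. ?w x *\<^sub>R F x \<partial>lborel)"
    by (rule integral_completion) simp
  also have "\<dots> = integral\<^sup>L torus_borel F"
    unfolding torus_borel_def w by (intro integral_density[symmetric]) auto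
  finally show ?thesis .
qed

lemma AE_torus_measureI:
  assumes "AE x in torus_borel. P x"
  shows "AE x in torus_measure. P x"
  using assms unfolding torus_measure_def torus_borel_def
  by (subst (asm) AE_density, simp, subst AE_density)
     (auto intro!: AE_completion measurable_completion)

section \<open>Dirichlet and Fejer kernels\<close>

definition dirichlet :: "nat \<Rightarrow> real \<Rightarrow> real" where
  "dirichlet m t = 1 + 2 * (\<Sum>k=1..m. cos (real k * t))"

definition max_dirichlet :: "nat \<Rightarrow> real \<Rightarrow> real" where
  "max_dirichlet N t = (MAX m\<in>{..N}. \<bar>dirichlet m t\<bar>)"

definition fejer :: "nat \<Rightarrow> real \<Rightarrow> real" where
  "fejer M t = (\<Sum>m\<le>M. dirichlet m t) / real (M + 1)"

lemma dirichlet_Suc: "dirichlet (Suc m) t = dirichlet m t + 2 * cos (real (Suc m) * t)"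
  by (simp add: dirichlet_def)

lemma continuous_dirichlet [continuous_intros]: "continuous_on A (dirichlet m)"
  unfolding dirichlet_def by (intro continuous_intros)

lemma measurable_dirichlet [measurable]: "dirichlet m \<in> borel_measurable borel"
  by (intro borel_measurable_continuous_onI continuous_intros)

lemma dirichlet_periodic: "dirichlet m (t + 2 * pi * of_int k) = dirichlet m t"
proof -
  have "cos (real i * (t + 2 * pi * of_int k)) = cos (real i * t)" for i
  proof -
    have "real i * (t + 2 * pi * of_int k) = real i * t + of_int (int i * k) * (2 * pi)"
      by (simp add: algebra_simps)
    also have "cos \<dots> = cos (real i * t)"
      using cos.plus_of_int[of "real i * t" "int i * k"] by simp
    finally show ?thesis .
  qed
  then show ?thesis by (simp add: dirichlet_def)
qed

lemma dirichlet_minus [simp]: "dirichlet m (- t) = dirichlet m t"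
  by (simp add: dirichlet_def)

lemma abs_dirichlet_le: "\<bar>dirichlet m t\<bar> \<le> 2 * real m + 1"
proof -
  have "\<bar>\<Sum>k=1..m. cos (real k * t)\<bar> \<le> (\<Sum>k=1..m. 1)"
    by (rule order.trans[OF sum_abs sum_mono]) simp
  then show ?thesis unfolding dirichlet_def by simp
qed

lemma dirichlet_2pi_minus: "dirichlet m (2 * pi - t) = dirichlet m t"
  using dirichlet_periodic[of m "- t" 1] by (simp add: add.commute)

text \<open>Multiplication by sin(t/2) telescopes the cosine sum. The product form is kept, rather
  than a quotient, since sin(t/2) vanishes on the period lattice.\<close>

lemma sin_half_mult_dirichlet: "sin (t / 2) * dirichlet m t = sin ((real m + 1 / 2) * t)"
proof (induction m)
  case (Suc m)
  have "sin (t / 2) * (2 * cos (real (Suc m) * t))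
      = sin (t / 2 + real (Suc m) * t) + sin (t / 2 - real (Suc m) * t)"
    by (simp add: sin_add sin_diff)
  also have "\<dots> = sin ((real (Suc m) + 1 / 2) * t) - sin ((real m + 1 / 2) * t)"
  proof -
    have "t / 2 + real (Suc m) * t = (real (Suc m) + 1 / 2) * t"
      and "t / 2 - real (Suc m) * t = - ((real m + 1 / 2) * t)"
      by (simp_all add: algebra_simps)
    then show ?thesis by (simp only: sin_minus)
  qed
  finally show ?case
    using Suc by (simp add: dirichlet_Suc distrib_left)
qed (simp add: dirichlet_def)

text \<open>A second factor sin(t/2) makes each Dirichlet kernel a difference of consecutive
  cosines, so the sum telescopes to a square. Positivity and decay of the Fejer kernel both come
  from here.\<close>

lemma sin_half_sq_mult_sum_dirichlet:
  "(sin (t / 2))\<^sup>2 * (\<Sum>m\<le>M. dirichlet m t) = (sin (real (M + 1) * t / 2))\<^sup>2"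
proof -
  have step: "2 * ((sin (t / 2))\<^sup>2 * dirichlet m t) = cos (real m * t) - cos (real (Suc m) * t)" for m
  proof -
    have "(sin (t / 2))\<^sup>2 * dirichlet m t = sin (t / 2) * sin ((real m + 1 / 2) * t)"
      by (simp add: power2_eq_square mult.assoc sin_half_mult_dirichlet)
    moreover have "cos (real m * t) = cos ((real m + 1 / 2) * t - t / 2)"
      "cos (real (Suc m) * t) = cos ((real m + 1 / 2) * t + t / 2)"
      by (simp_all add: algebra_simps)
    ultimately show ?thesis by (simp add: cos_add cos_diff)
  qed
  have "2 * ((sin (t / 2))\<^sup>2 * (\<Sum>m\<le>M. dirichlet m t)) = (\<Sum>m\<le>M. cos (real m * t) - cos (real (Suc m) * t))"
    by (simp only: sum_distrib_left step)
  also have "\<dots> = 1 - cos (real (M + 1) * t)"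
    by (induction M) simp_all
  also have "\<dots> = 2 * (sin (real (M + 1) * t / 2))\<^sup>2"
    using cos_double_sin[of "real (M + 1) * t / 2"] by simp
  finally show ?thesis by simp
qed

lemma dirichlet_at_zero_of_sin_half:
  assumes "sin (t / 2) = 0"
  shows "dirichlet m t = 2 * real m + 1"
proof -
  obtain i :: int where "t / 2 = of_int i * pi"
    using assms sin_zero_iff_int2 by blast
  then have "t = 0 + 2 * pi * of_int i" by simp
  then show ?thesis
    by (simp only: dirichlet_periodic) (simp add: dirichlet_def)
qed

lemma fejer_nonneg: "0 \<le> fejer M t"
proof (cases "sin (t / 2) = 0")
  case True
  then show ?thesis
    by (simp add: fejer_def dirichlet_at_zero_of_sin_half sum_nonneg)
next
  case False
  then have "0 < (sin (t / 2))\<^sup>2" by simp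
  moreover have "0 \<le> (sin (t / 2))\<^sup>2 * (\<Sum>m\<le>M. dirichlet m t)"
    by (simp only: sin_half_sq_mult_sum_dirichlet) simp
  ultimately have "0 \<le> (\<Sum>m\<le>M. dirichlet m t)"
    by (simp add: zero_le_mult_iff)
  then show ?thesis by (simp add: fejer_def)
qed

lemma sin_half_sq_mult_fejer_le: "(sin (t / 2))\<^sup>2 * fejer M t \<le> 1 / real (M + 1)"
proof -
  have "(sin (t / 2))\<^sup>2 * fejer M t = (sin (real (M + 1) * t / 2))\<^sup>2 / real (M + 1)"
    by (simp only: fejer_def times_divide_eq_right sin_half_sq_mult_sum_dirichlet)
  also have "\<dots> \<le> 1 / real (M + 1)"
    by (intro divide_right_mono) (simp_all add: abs_square_le_1)
  finally show ?thesis .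
qed

text \<open>Jordan's inequality: sine is concave here, so it lies above its chord.\<close>

lemma sin_ge_chord:
  assumes "0 \<le> x" "x \<le> pi / 2"
  shows "2 * x / pi \<le> sin x"
proof -
  have "convex_on {0..pi / 2} (\<lambda>x. - sin x)"
    by (rule f''_ge0_imp_convex[where f' = "\<lambda>x. - cos x" and f'' = sin])
       (auto intro!: derivative_eq_intros sin_ge_zero)
  from convex_onD[OF this, of "2 * x / pi" 0 "pi / 2"] assms show ?thesis
    by (simp add: field_simps)
qed

lemma abs_sin_half_ge_torus_abs: "torus_abs t / pi \<le> \<bar>sin (t / 2)\<bar>"
proof -
  \<comment> \<open>The nearest lattice point: \<open>s\<close> represents \<open>t\<close> in
    [-pi, pi], so half its modulus lies in the range of the chord bound.\<close>
  define k where "k = round (t / (2 * pi))"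
  define s where "s = t - 2 * pi * of_int k"
  have "\<bar>of_int k - t / (2 * pi)\<bar> \<le> 1 / 2"
    unfolding k_def by (rule of_int_round_abs_le)
  then have "\<bar>2 * pi * (of_int k - t / (2 * pi))\<bar> \<le> pi"
    by (simp add: abs_mult)
  then have s: "\<bar>s\<bar> \<le> pi"
    by (simp add: s_def right_diff_distrib abs_minus_commute)
  have "torus_abs t \<le> \<bar>s\<bar>"
    unfolding torus_abs_def s_def
    by (rule order.trans[OF infdist_le[of "2 * pi * of_int k"]]) (auto simp: dist_real_def)
  then have "torus_abs t / pi \<le> 2 * (\<bar>s\<bar> / 2) / pi"
    by (simp add: divide_right_mono)
  also have "\<dots> \<le> sin (\<bar>s\<bar> / 2)"
    using s by (intro sin_ge_chord) auto
  also have "\<dots> \<le> \<bar>sin (s / 2)\<bar>"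
    by (cases "s \<ge> 0") (auto simp: abs_if)
  also have "\<bar>sin (s / 2)\<bar> = \<bar>sin (t / 2)\<bar>"
  proof -
    have "s / 2 = t / 2 + of_int (- k) * pi" by (simp add: s_def field_simps)
    moreover have "sin (of_int (- k) * pi) = 0"
      using sin_zero_iff_int2 by blast
    ultimately show ?thesis
      by (simp only: sin_add mult_zero_right add_0_right abs_mult sin_zero_abs_cos_one mult_1_right)
  qed
  finally show ?thesis .
qed

lemma fejer_tail:
  assumes "0 < \<delta>" "\<delta> < torus_abs t"
  shows "fejer M t \<le> pi\<^sup>2 / (real (M + 1) * \<delta>\<^sup>2)"
proof -
  have "\<delta> / pi \<le> \<bar>sin (t / 2)\<bar>"
    using abs_sin_half_ge_torus_abs[of t] assms by (smt (verit) divide_right_mono pi_gt_zero)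
  then have "(\<delta> / pi)\<^sup>2 \<le> \<bar>sin (t / 2)\<bar>\<^sup>2"
    using assms by (intro power_mono) auto
  then have "(\<delta> / pi)\<^sup>2 * fejer M t \<le> (sin (t / 2))\<^sup>2 * fejer M t"
    by (intro mult_right_mono) (simp_all add: fejer_nonneg)
  also note sin_half_sq_mult_fejer_le
  finally show ?thesis
    using assms by (subst pos_le_divide_eq) (simp_all add: field_simps add_pos_nonneg)
qed

lemma max_dirichlet_ge: "m \<le> N \<Longrightarrow> \<bar>dirichlet m t\<bar> \<le> max_dirichlet N t"
  unfolding max_dirichlet_def by (intro Max_ge) auto

lemma max_dirichlet_nonneg: "0 \<le> max_dirichlet N t"
  using max_dirichlet_ge[of 0 N t] by (smt (verit) abs_ge_zero le0)

lemma max_dirichlet_leI: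
  "(\<And>m. m \<le> N \<Longrightarrow> \<bar>dirichlet m t\<bar> \<le> c) \<Longrightarrow> max_dirichlet N t \<le> c"
  unfolding max_dirichlet_def by (subst Max_le_iff) auto

lemma measurable_max_dirichlet [measurable]: "max_dirichlet N \<in> borel_measurable borel"
  unfolding max_dirichlet_def[abs_def] by measurable

text \<open>
  The bound is a smooth substitute for \<open>min (2 N + 1) (\<pi> / t)\<close>, using \<open>min u v \<le> 2 / (1 / u + 1 / v)\<close>,
  at both ends of the period.
\<close>

lemma max_dirichlet_bound:
  assumes "0 < t" "t < 2 * pi"
  shows "max_dirichlet N t
    \<le> 2 * pi / (pi / (2 * real N + 1) + t) + 2 * pi / (pi / (2 * real N + 1) + (2 * pi - t))"
proof -
  let ?c = "pi / (2 * real N + 1)"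
  have c: "0 < ?c" by simp
  \<comment> \<open>One bound per half period; reflection about pi gives the other half. As
    \<open>?c\<close> is pi divided by the trivial bound 2 N + 1, the estimates of \<open>s\<close>
    and of \<open>?c\<close> times the kernel by pi can simply be added.\<close>
  have half: "\<bar>dirichlet m s\<bar> \<le> 2 * pi / (?c + s)" if "m \<le> N" "0 < s" "s \<le> pi" for m s
  proof -
    have "s / pi \<le> sin (s / 2)"
      using sin_ge_chord[of "s / 2"] that by simp
    then have "s / pi * \<bar>dirichlet m s\<bar> \<le> sin (s / 2) * \<bar>dirichlet m s\<bar>"
      by (rule mult_right_mono) simp
    also have "\<dots> \<le> \<bar>sin (s / 2) * dirichlet m s\<bar>"
      by (simp add: abs_mult mult_right_mono)
    also have "\<dots> \<le> 1" by (simp add: sin_half_mult_dirichlet)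
    finally have 1: "s * \<bar>dirichlet m s\<bar> \<le> pi" by (simp add: field_simps)
    have "\<bar>dirichlet m s\<bar> \<le> 2 * real N + 1"
      using abs_dirichlet_le[of m s] that by simp
    then have "?c * \<bar>dirichlet m s\<bar> \<le> ?c * (2 * real N + 1)"
      using c by (intro mult_left_mono) auto
    then have "?c * \<bar>dirichlet m s\<bar> \<le> pi" by simp
    with 1 have "\<bar>dirichlet m s\<bar> * (?c + s) \<le> 2 * pi"
      by (simp only: distrib_left mult.commute[of "\<bar>dirichlet m s\<bar>"])
    moreover have "0 < ?c + s" by (rule add_pos_pos[OF c that(2)])
    ultimately show ?thesis by (simp only: pos_le_divide_eq)
  qed
  show ?thesis
  proof (rule max_dirichlet_leI)
    fix m assume m: "m \<le> N"
    have pos: "0 \<le> 2 * pi / (?c + t)" "0 \<le> 2 * pi / (?c + (2 * pi - t))"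
      using assms c by (intro divide_nonneg_nonneg; linarith)+
    show "\<bar>dirichlet m t\<bar> \<le> 2 * pi / (?c + t) + 2 * pi / (?c + (2 * pi - t))"
    proof (cases "t \<le> pi")
      case True
      then show ?thesis using half[OF m, of t] assms pos by linarith
    next
      case False
      then show ?thesis
        using half[OF m, of "2 * pi - t"] assms pos dirichlet_2pi_minus[of m t] by linarith
    qed
  qed
qed

text \<open>The smooth majorant has a logarithmic primitive, so its integral is exact: with c = pi /
  (2 N + 1) the ratio (c + 2 pi) / c is 4 N + 3, and each end of the period contributes one
  logarithm of it.\<close>

lemma nn_integral_max_dirichlet:
  "(\<integral>\<^sup>+t. ennreal (max_dirichlet N t) \<partial>circle_borel) \<le> ennreal (2 * ln (4 * real N + 3))"
proof -
  let ?c = "pi / (2 * real N + 1)"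
  have c: "0 < ?c" by simp
  let ?g = "\<lambda>t. 1 / (?c + t) + 1 / (?c + (2 * pi - t))"
  let ?G = "\<lambda>t. ln (?c + t) - ln (?c + (2 * pi - t))"
  have "(\<integral>\<^sup>+t. ennreal (max_dirichlet N t) \<partial>circle_borel)
    = (\<integral>\<^sup>+t. ennreal (1 / (2 * pi)) * indicator {0..<2 * pi} t * ennreal (max_dirichlet N t) \<partial>lborel)"
    unfolding circle_borel_def by (rule nn_integral_density) auto
  also have "\<dots> \<le> (\<integral>\<^sup>+t. ennreal (?g t) * indicator {0..2 * pi} t \<partial>lborel)"
  proof (rule nn_integral_mono_AE)
    have "AE t :: real in lborel. t \<noteq> 0" using AE_lborel_singleton[of "0::real"] .
    then show "AE t in lborel. ennreal (1 / (2 * pi)) * indicator {0..<2 * pi} t * ennreal (max_dirichlet N t)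
      \<le> ennreal (?g t) * indicator {0..2 * pi} t"
    proof eventually_elim
      case (elim t)
      show ?case
      proof (cases "0 \<le> t \<and> t < 2 * pi")
        case True
        with elim have t: "0 < t" "t < 2 * pi" by auto
        have "1 / (2 * pi) * max_dirichlet N t \<le> 1 / (2 * pi) * (2 * pi / (?c + t) + 2 * pi / (?c + (2 * pi - t)))"
          by (intro mult_left_mono max_dirichlet_bound t) simp
        also have "\<dots> = ?g t" by (simp only: distrib_left) simp
        finally have "ennreal (1 / (2 * pi)) * ennreal (max_dirichlet N t) \<le> ennreal (?g t)"
          by (subst ennreal_mult[symmetric]) (auto intro!: ennreal_leI max_dirichlet_nonneg)
        then show ?thesis using t by simp
      qed (auto split: split_indicator)
    qed
  qed
  also have "\<dots> = ennreal (?G (2 * pi) - ?G 0)"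
  proof (rule nn_integral_FTC_Icc)
    fix t :: real assume "t \<in> {0..2 * pi}"
    then have t: "0 \<le> t" "t \<le> 2 * pi" by auto
    have p: "0 < ?c + t" "0 < ?c + (2 * pi - t)" using t c by linarith+
    show "0 \<le> ?g t" using p by (intro add_nonneg_nonneg divide_nonneg_pos) auto
    show "(?G has_real_derivative ?g t) (at t)"
      using p by (auto intro!: derivative_eq_intros)
  qed auto
  also have "?G (2 * pi) - ?G 0 = 2 * ln (4 * real N + 3)"
  proof -
    have "?c + 2 * pi = ?c * (4 * real N + 3)" by (simp add: field_simps)
    then have "ln (?c + 2 * pi) = ln ?c + ln (4 * real N + 3)"
      by (simp only:) (rule ln_mult_pos; simp)
    then show ?thesis by simp
  qed
  finally show ?thesis .
qed

lemma measurable_fejer [measurable]: "fejer M \<in> borel_measurable borel"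
  unfolding fejer_def[abs_def] by measurable

lemma nn_integral_fejer: "(\<integral>\<^sup>+t. ennreal (fejer M t) \<partial>circle_borel) = 1"
proof -
  \<comment> \<open>Termwise primitive: each cosine contributes a sine that vanishes at both ends of
    the period, so only the linear term survives.\<close>
  let ?D = "\<lambda>m t. t + 2 * (\<Sum>k=1..m. sin (real k * t) / real k)"
  let ?G = "\<lambda>t. (\<Sum>m\<le>M. ?D m t) / real (M + 1) / (2 * pi)"
  have D: "(?D m has_real_derivative dirichlet m t) (at t within A)" for m t A
  proof -
    have "((\<lambda>t. sin (real k * t) / real k) has_real_derivative cos (real k * t)) (at t within A)"
      if "k \<in> {1..m}" for k
      using that by (auto intro!: derivative_eq_intros)
    then show ?thesis
      unfolding dirichlet_def by (auto intro!: DERIV_add DERIV_cmult DERIV_sum DERIV_ident)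
  qed
  have "(\<integral>\<^sup>+t. ennreal (fejer M t) \<partial>circle_borel)
    = (\<integral>\<^sup>+t. ennreal (1 / (2 * pi)) * indicator {0..<2 * pi} t * ennreal (fejer M t) \<partial>lborel)"
    unfolding circle_borel_def by (rule nn_integral_density) auto
  also have "\<dots> = (\<integral>\<^sup>+t. ennreal (fejer M t / (2 * pi)) * indicator {0..2 * pi} t \<partial>lborel)"
  proof (rule nn_integral_cong_AE)
    have "AE t :: real in lborel. t \<noteq> 2 * pi" using AE_lborel_singleton[of "2 * pi"] by simp
    then show "AE t in lborel. ennreal (1 / (2 * pi)) * indicator {0..<2 * pi} t * ennreal (fejer M t)
      = ennreal (fejer M t / (2 * pi)) * indicator {0..2 * pi} t"
    proof eventually_elim
      case (elim t)
      have "ennreal (1 / (2 * pi)) * ennreal (fejer M t) = ennreal (fejer M t / (2 * pi))"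
        by (subst ennreal_mult[symmetric]) (auto simp: fejer_nonneg)
      with elim show ?case by (auto split: split_indicator)
    qed
  qed
  also have "\<dots> = ennreal (?G (2 * pi) - ?G 0)"
  proof (rule nn_integral_FTC_Icc)
    fix t :: real
    show "(?G has_real_derivative fejer M t / (2 * pi)) (at t)"
      unfolding fejer_def
      by (intro DERIV_cdivide DERIV_sum D)
  qed (auto simp: fejer_nonneg)
  also have "?G (2 * pi) - ?G 0 = 1"
  proof -
    have "sin (real k * (2 * pi)) = 0" for k
      using sin_npi[of "2 * k"] by (simp add: mult_ac)
    then have "?G (2 * pi) - ?G 0 = real (M + 1) * (2 * pi) / real (M + 1) / (2 * pi)"
      by simp
    also have "\<dots> = 1"
      using pi_neq_zero by (subst nonzero_mult_div_cancel_left) auto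
    finally show ?thesis .
  qed
  finally show ?thesis by simp
qed

section \<open>Characters and product kernels in several variables\<close>

abbreviation freq_box :: "nat ^ 'd \<Rightarrow> (int ^ 'd) set" where
  "freq_box n \<equiv> {k. \<forall>j. \<bar>k $ j\<bar> \<le> int (n $ j)}"

definition index_box :: "nat \<Rightarrow> (nat ^ 'd) set" where
  "index_box N = {n. \<forall>j. n $ j \<le> N}"

definition character :: "int ^ 'd \<Rightarrow> real ^ 'd \<Rightarrow> complex" where
  "character k x = exp (\<i> * complex_of_real (freq_dot k x))"

definition dirichlet_vec :: "nat ^ 'd \<Rightarrow> real ^ 'd \<Rightarrow> real" where
  "dirichlet_vec n x = (\<Prod>j\<in>UNIV. dirichlet (n $ j) (x $ j))"

definition max_dirichlet_vec :: "nat \<Rightarrow> real ^ 'd \<Rightarrow> real" where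
  "max_dirichlet_vec N x = (\<Prod>j\<in>UNIV. max_dirichlet N (x $ j))"

definition fejer_vec :: "nat \<Rightarrow> real ^ 'd \<Rightarrow> real" where
  "fejer_vec M x = (\<Prod>j\<in>UNIV. fejer M (x $ j))"

lemma prod_sum_vec:
  fixes f :: "'d :: finite \<Rightarrow> 'b \<Rightarrow> 'c :: comm_semiring_1"
  assumes "\<And>j. finite (A j)"
  shows "(\<Prod>j\<in>UNIV. \<Sum>y\<in>A j. f j y) = (\<Sum>v\<in>{v. \<forall>j. v $ j \<in> A j}. \<Prod>j\<in>UNIV. f j (v $ j))"
proof -
  have "(\<Prod>j\<in>UNIV. \<Sum>y\<in>A j. f j y) = (\<Sum>g\<in>Pi\<^sub>E UNIV A. \<Prod>j\<in>UNIV. f j (g j))"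
    by (rule prod_sum_PiE) (use assms in auto)
  also have "\<dots> = (\<Sum>v\<in>{v. \<forall>j. v $ j \<in> A j}. \<Prod>j\<in>UNIV. f j (v $ j))"
    by (rule sum.reindex_bij_witness[where i = vec_nth and j = vec_lambda])
       (auto simp: PiE_UNIV_domain)
  finally show ?thesis .
qed

lemma finite_index_box: "finite (index_box N)"
proof (rule finite_subset)
  show "index_box N \<subseteq> vec_lambda ` (Pi\<^sub>E UNIV (\<lambda>_. {..N}))"
  proof
    fix n :: "nat ^ 'd" assume "n \<in> index_box N"
    then have "vec_nth n \<in> Pi\<^sub>E UNIV (\<lambda>_. {..N})"
      by (simp add: index_box_def PiE_UNIV_domain)
    then show "n \<in> vec_lambda ` (Pi\<^sub>E UNIV (\<lambda>_. {..N}))"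
      by (metis imageI vec_nth_inverse)
  qed
qed (simp add: finite_PiE)

lemma index_box_nonempty: "index_box N \<noteq> {}"
  by (auto simp: index_box_def intro!: exI[of _ "0 :: nat ^ _"])

lemma freq_dot_add: "freq_dot k (x + y) = freq_dot k x + freq_dot k y"
  by (simp add: freq_dot_def distrib_left sum.distrib)

lemma freq_dot_minus: "freq_dot k (- x) = - freq_dot k x"
  by (simp add: freq_dot_def sum_negf)

lemma character_add: "character k (x + y) = character k x * character k y"
  by (simp add: character_def freq_dot_add distrib_left exp_add)

lemma character_minus: "character k (- x) = cnj (character k x)"
  by (simp add: character_def freq_dot_minus exp_cnj)

lemma character_diff: "character k (x - y) = character k x * cnj (character k y)"
  using character_add[of k x "- y"] by (simp add: character_minus)

lemma norm_character [simp]: "norm (character k x) = 1"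
  by (simp add: character_def)

lemma continuous_character: "continuous_on A (character k)"
  unfolding character_def freq_dot_def by (intro continuous_intros)

lemma measurable_character [measurable]: "character k \<in> borel_measurable borel"
  by (intro borel_measurable_continuous_onI continuous_character)

lemma torus_periodic_character: "torus_periodic (character k)"
proof -
  have "character k (lattice_vec l) = 1" for l
  proof -
    have "freq_dot k (lattice_vec l) = 2 * pi * of_int (\<Sum>j\<in>UNIV. k $ j * l $ j)"
      by (simp add: freq_dot_def lattice_vec_def sum_distrib_left mult_ac)
    then show ?thesis
      unfolding character_def
      by (simp only: exp_eq_1) (auto intro!: exI[of _ "\<Sum>j\<in>UNIV. k $ j * l $ j"])
  qed
  then show ?thesis
    by (simp add: torus_periodic_iff character_add)
qed

lemma sum_exp_eq_dirichlet:
  "(\<Sum>k\<in>{- int m..int m}. exp (\<i> * complex_of_real (of_int k * t))) = complex_of_real (dirichlet m t)"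
proof (induction m)
  case (Suc m)
  have "{- int (Suc m)..int (Suc m)} = insert (int (Suc m)) (insert (- int (Suc m)) {- int m..int m})"
    by auto
  moreover have "exp (\<i> * complex_of_real (of_int (int (Suc m)) * t))
        + exp (\<i> * complex_of_real (of_int (- int (Suc m)) * t))
      = complex_of_real (2 * cos (real (Suc m) * t))"
    using cos_exp_eq[of "complex_of_real (real (Suc m) * t)"]
    by (simp only: cos_of_real of_int_minus of_int_of_nat_eq mult_minus_left mult_minus_right of_real_minus)
       (simp add: add_divide_distrib flip: cos_of_real)
  ultimately show ?case
    using Suc by (simp add: dirichlet_Suc add_ac)
qed (simp add: dirichlet_def)

lemma sum_character_eq_dirichlet_vec:
  "(\<Sum>k\<in>freq_box n. character k x) = complex_of_real (dirichlet_vec n x)"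
proof -
  have *: "character k x = (\<Prod>j\<in>UNIV. exp (\<i> * complex_of_real (of_int (k $ j) * x $ j)))" for k
    by (simp add: character_def freq_dot_def sum_distrib_left exp_sum)
  have "complex_of_real (dirichlet_vec n x)
      = (\<Prod>j\<in>UNIV. \<Sum>k\<in>{- int (n $ j)..int (n $ j)}. exp (\<i> * complex_of_real (of_int k * x $ j)))"
    by (simp only: sum_exp_eq_dirichlet dirichlet_vec_def of_real_prod)
  also have "\<dots> = (\<Sum>k\<in>{k. \<forall>j. k $ j \<in> {- int (n $ j)..int (n $ j)}}. character k x)"
    unfolding * by (rule prod_sum_vec) simp
  also have "{k. \<forall>j. k $ j \<in> {- int (n $ j)..int (n $ j)}} = freq_box n"
    by (auto simp: abs_le_iff minus_le_iff)
  finally show ?thesis ..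
qed

text \<open>Expanding the product of one-dimensional averages gives the average over all rectangles
  with sides up to \<open>M\<close>. This ties the product form, which shows positivity and mass
  one, to the average of partial sums in \<open>fejer_mean\<close>.\<close>

lemma fejer_vec_eq:
  "fejer_vec M x = (\<Sum>n\<in>index_box M. dirichlet_vec n x) / real (M + 1) ^ CARD('d)"
  for x :: "real ^ 'd"
proof -
  have "(\<Prod>j\<in>UNIV. \<Sum>m\<in>{..M}. dirichlet m (x $ j)) = (\<Sum>n\<in>index_box M. dirichlet_vec n x)"
    unfolding dirichlet_vec_def index_box_def by (subst prod_sum_vec) auto
  then show ?thesis
    by (simp add: fejer_vec_def fejer_def prod_dividef)
qed

lemma fejer_vec_nonneg: "0 \<le> fejer_vec M x"
  unfolding fejer_vec_def by (intro prod_nonneg) (simp add: fejer_nonneg)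

lemma max_dirichlet_vec_nonneg: "0 \<le> max_dirichlet_vec N x"
  unfolding max_dirichlet_vec_def by (intro prod_nonneg) (simp add: max_dirichlet_nonneg)

lemma abs_dirichlet_vec_le: "n \<in> index_box N \<Longrightarrow> \<bar>dirichlet_vec n x\<bar> \<le> max_dirichlet_vec N x"
  unfolding dirichlet_vec_def max_dirichlet_vec_def abs_prod
  by (intro prod_mono) (auto simp: index_box_def intro: max_dirichlet_ge)

lemma measurable_dirichlet_vec [measurable]: "dirichlet_vec n \<in> borel_measurable borel"
  unfolding dirichlet_vec_def[abs_def] by measurable

lemma measurable_max_dirichlet_vec [measurable]: "max_dirichlet_vec N \<in> borel_measurable borel"
  unfolding max_dirichlet_vec_def[abs_def] by measurable

lemma measurable_fejer_vec [measurable]: "fejer_vec M \<in> borel_measurable borel"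
  unfolding fejer_vec_def[abs_def] by measurable

lemma dirichlet_vec_minus: "dirichlet_vec n (- x) = dirichlet_vec n x"
  by (simp add: dirichlet_vec_def)

lemma fejer_vec_minus: "fejer_vec M (- x) = fejer_vec M x"
  by (simp add: fejer_vec_eq dirichlet_vec_minus)

lemma torus_periodic_fejer_vec: "torus_periodic (fejer_vec M)"
  by (simp add: torus_periodic_def fejer_vec_def fejer_def dirichlet_periodic)

lemma torus_periodic_max_dirichlet_vec: "torus_periodic (max_dirichlet_vec N)"
  by (simp add: torus_periodic_def max_dirichlet_vec_def max_dirichlet_def dirichlet_periodic)

lemma nn_integral_max_dirichlet_vec:
  "(\<integral>\<^sup>+x. ennreal (max_dirichlet_vec N (x :: real ^ 'd)) \<partial>torus_borel)
     \<le> ennreal ((2 * ln (4 * real N + 3)) ^ CARD('d))"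
proof -
  have "(\<integral>\<^sup>+x. ennreal (max_dirichlet_vec N (x :: real ^ 'd)) \<partial>torus_borel)
    = (\<Prod>j\<in>(UNIV :: 'd set). \<integral>\<^sup>+t. ennreal (max_dirichlet N t) \<partial>circle_borel)"
    unfolding max_dirichlet_vec_def
    by (subst nn_integral_torus_prod[symmetric]) (auto simp: prod_ennreal max_dirichlet_nonneg)
  also have "\<dots> \<le> (\<Prod>j\<in>(UNIV :: 'd set). ennreal (2 * ln (4 * real N + 3)))"
    by (rule prod_mono_ennreal) (rule nn_integral_max_dirichlet)
  finally show ?thesis by (simp add: ennreal_power)
qed

lemma nn_integral_fejer_vec: "(\<integral>\<^sup>+x. ennreal (fejer_vec M (x :: real ^ 'd)) \<partial>torus_borel) = 1"
proof -
  have "(\<integral>\<^sup>+x. ennreal (fejer_vec M (x :: real ^ 'd)) \<partial>torus_borel)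
    = (\<Prod>j\<in>(UNIV :: 'd set). \<integral>\<^sup>+t. ennreal (fejer M t) \<partial>circle_borel)"
    unfolding fejer_vec_def
    by (subst nn_integral_torus_prod[symmetric]) (auto simp: prod_ennreal fejer_nonneg)
  then show ?thesis by (simp add: nn_integral_fejer)
qed

section \<open>Maximal partial sums\<close>

interpretation torus_prob: prob_space "torus_borel :: (real ^ 'd) measure"
  by (rule prob_space_torus_borel)

lemma measure_torus_borel_UNIV [simp]: "measure torus_borel (UNIV :: (real ^ 'd) set) = 1"
  using torus_prob.prob_space by simp

lemma measurable_cnj [measurable]: "cnj \<in> borel_measurable borel"
  by (intro borel_measurable_continuous_onI continuous_intros)

text \<open>Bound for the L1 norm of \<open>max_dirichlet_vec N\<close> in dimension
  \<open>d\<close>; both endpoint estimates depend on \<open>N\<close> only through it.\<close>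

definition kernel_const :: "nat \<Rightarrow> nat \<Rightarrow> real" where
  "kernel_const d N = (2 * ln (4 * real N + 3)) ^ d"

lemma kernel_const_pos: "0 < kernel_const d N"
  unfolding kernel_const_def by (intro zero_less_power) (simp add: ln_gt_zero)

definition max_partial_sum :: "nat \<Rightarrow> (real ^ 'd \<Rightarrow> complex) \<Rightarrow> real ^ 'd \<Rightarrow> real" where
  "max_partial_sum N f x = (MAX n\<in>index_box N. norm (rect_partial_sum n f x))"

lemma integrable_bounded_torus:
  fixes u :: "real ^ 'd \<Rightarrow> complex"
  assumes "u \<in> borel_measurable borel" "\<And>x. norm (u x) \<le> c"
  shows "integrable torus_borel u"
  by (rule torus_prob.integrable_const_bound[of _ c]) (use assms in auto)

lemma integrable_mult_bounded_torus:
  fixes f u :: "real ^ 'd \<Rightarrow> complex"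
  assumes f: "integrable torus_borel f" and [measurable]: "u \<in> borel_measurable borel"
    and u: "\<And>x. norm (u x) \<le> c"
  shows "integrable torus_borel (\<lambda>x. f x * u x)"
proof (rule Bochner_Integration.integrable_bound)
  have [measurable]: "f \<in> borel_measurable borel"
    using borel_measurable_integrable[OF f] by simp
  show "(\<lambda>x. f x * u x) \<in> borel_measurable torus_borel" by simp
  show "integrable torus_borel (\<lambda>x. c * norm (f x))" using f by simp
  show "AE x in torus_borel. norm (f x * u x) \<le> norm (c * norm (f x))"
  proof (intro AE_I2)
    fix x
    have "norm (f x) * norm (u x) \<le> norm (f x) * c"
      by (rule mult_left_mono[OF u]) simp
    then show "norm (f x * u x) \<le> norm (c * norm (f x))"
      by (simp add: norm_mult mult.commute)
  qed
qed

lemma fourier_coeff_eq: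
  assumes [measurable]: "f \<in> borel_measurable borel"
  shows "fourier_coeff f k = (\<integral>x. f x * cnj (character k x) \<partial>torus_borel)"
proof -
  have "exp (- (\<i> * complex_of_real (freq_dot k x))) = cnj (character k x)" for x
    by (simp add: character_def exp_cnj)
  then show ?thesis
    unfolding fourier_coeff_def by (simp add: integral_torus_measure)
qed

lemma integrable_fourier_coeff:
  assumes "integrable torus_borel f"
  shows "integrable torus_borel (\<lambda>x. f x * cnj (character k x))"
  by (rule integrable_mult_bounded_torus[OF assms, of _ 1]) simp_all

lemma rect_partial_sum_eq:
  "rect_partial_sum n f x = (\<Sum>k\<in>freq_box n. fourier_coeff f k * character k x)"
  by (simp add: rect_partial_sum_def character_def)

lemma measurable_rect_partial_sum [measurable]: "rect_partial_sum n f \<in> borel_measurable borel"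
  unfolding rect_partial_sum_eq[abs_def] by measurable

lemma measurable_max_partial_sum [measurable]: "max_partial_sum N f \<in> borel_measurable borel"
  unfolding max_partial_sum_def[abs_def] using finite_index_box by measurable

lemma norm_rect_partial_sum_le_max:
  "n \<in> index_box N \<Longrightarrow> norm (rect_partial_sum n f x) \<le> max_partial_sum N f x"
  unfolding max_partial_sum_def by (intro Max_ge) (auto simp: finite_index_box)

lemma max_partial_sum_leI:
  "(\<And>n. n \<in> index_box N \<Longrightarrow> norm (rect_partial_sum n f x) \<le> c) \<Longrightarrow> max_partial_sum N f x \<le> c"
  unfolding max_partial_sum_def by (subst Max_le_iff) (auto simp: finite_index_box index_box_nonempty)

lemma max_partial_sum_attained:
  obtains n where "n \<in> index_box N" "max_partial_sum N f x = norm (rect_partial_sum n f x)"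
proof -
  have "max_partial_sum N f x \<in> (\<lambda>n. norm (rect_partial_sum n f x)) ` index_box N"
    unfolding max_partial_sum_def
    by (rule Max_in) (simp_all add: finite_index_box index_box_nonempty)
  then show ?thesis using that by blast
qed

lemma max_partial_sum_nonneg: "0 \<le> max_partial_sum N f x"
proof -
  obtain n :: "nat ^ 'a" where "n \<in> index_box N" using index_box_nonempty by blast
  then show ?thesis using norm_rect_partial_sum_le_max norm_ge_zero order.trans by metis
qed

lemma fourier_coeff_add:
  assumes f: "integrable torus_borel f" and g: "integrable torus_borel g"
  shows "fourier_coeff (\<lambda>x. f x + g x) k = fourier_coeff f k + fourier_coeff g k"
proof -
  have [measurable]: "f \<in> borel_measurable borel" "g \<in> borel_measurable borel"
    using borel_measurable_integrable[OF f] borel_measurable_integrable[OF g] by simp_all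
  show ?thesis
    by (simp add: fourier_coeff_eq distrib_right integrable_fourier_coeff f g)
qed

lemma fourier_coeff_diff:
  assumes f: "integrable torus_borel f" and g: "integrable torus_borel g"
  shows "fourier_coeff (\<lambda>x. f x - g x) k = fourier_coeff f k - fourier_coeff g k"
proof -
  have [measurable]: "f \<in> borel_measurable borel" "g \<in> borel_measurable borel"
    using borel_measurable_integrable[OF f] borel_measurable_integrable[OF g] by simp_all
  show ?thesis
    by (simp add: fourier_coeff_eq left_diff_distrib integrable_fourier_coeff f g)
qed

lemma rect_partial_sum_add:
  assumes "integrable torus_borel f" "integrable torus_borel g"
  shows "rect_partial_sum n (\<lambda>x. f x + g x) x = rect_partial_sum n f x + rect_partial_sum n g x"
  by (simp add: rect_partial_sum_eq fourier_coeff_add[OF assms] distrib_right sum.distrib)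

lemma rect_partial_sum_diff:
  assumes "integrable torus_borel f" "integrable torus_borel g"
  shows "rect_partial_sum n (\<lambda>x. f x - g x) x = rect_partial_sum n f x - rect_partial_sum n g x"
  by (simp add: rect_partial_sum_eq fourier_coeff_diff[OF assms] left_diff_distrib sum_subtractf)

lemma max_partial_sum_add:
  assumes "integrable torus_borel f" "integrable torus_borel g"
  shows "max_partial_sum N (\<lambda>x. f x + g x) x \<le> max_partial_sum N f x + max_partial_sum N g x"
  by (rule max_partial_sum_leI)
     (auto simp: rect_partial_sum_add[OF assms]
        intro!: norm_triangle_le add_mono norm_rect_partial_sum_le_max)

lemma rect_partial_sum_kernel:
  assumes f: "integrable torus_borel f"
  shows "rect_partial_sum n f x = (\<integral>y. f y * complex_of_real (dirichlet_vec n (x - y)) \<partial>torus_borel)"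
proof -
  have [measurable]: "f \<in> borel_measurable borel"
    using borel_measurable_integrable[OF f] by simp
  have "rect_partial_sum n f x
      = (\<integral>y. (\<Sum>k\<in>freq_box n. f y * cnj (character k y) * character k x) \<partial>torus_borel)"
    by (simp add: rect_partial_sum_eq fourier_coeff_eq integrable_fourier_coeff[OF f])
  also have "\<dots> = (\<integral>y. f y * complex_of_real (dirichlet_vec n (x - y)) \<partial>torus_borel)"
    by (simp add: sum_character_eq_dirichlet_vec[symmetric] character_diff sum_distrib_left mult_ac)
  finally show ?thesis .
qed

lemma torus_periodic_comp: "torus_periodic f \<Longrightarrow> torus_periodic (\<lambda>x. g (f x))"
  by (simp add: torus_periodic_def)

lemma nn_integral_max_dirichlet_vec_shift:
  fixes x :: "real ^ 'd"
  shows "(\<integral>\<^sup>+y. ennreal (max_dirichlet_vec N (x - y)) \<partial>torus_borel) \<le> ennreal (kernel_const CARD('d) N)"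
    and "(\<integral>\<^sup>+y. ennreal (max_dirichlet_vec N (y - x)) \<partial>torus_borel) \<le> ennreal (kernel_const CARD('d) N)"
proof -
  have "max_dirichlet_vec N (- z) = max_dirichlet_vec N z" for z :: "real ^ 'd"
    by (simp add: max_dirichlet_vec_def max_dirichlet_def)
  from this[of "x - _"]
  have "(\<integral>\<^sup>+y. ennreal (max_dirichlet_vec N (x - y)) \<partial>torus_borel)
      = (\<integral>\<^sup>+y. ennreal (max_dirichlet_vec N (y - x)) \<partial>torus_borel)" by simp
  moreover have "(\<integral>\<^sup>+y. ennreal (max_dirichlet_vec N (y - x)) \<partial>torus_borel)
      = (\<integral>\<^sup>+y. ennreal (max_dirichlet_vec N (y :: real ^ 'd)) \<partial>torus_borel)"
  proof -
    have "torus_periodic (\<lambda>y :: real ^ 'd. ennreal (max_dirichlet_vec N y))"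
      by (rule torus_periodic_comp[OF torus_periodic_max_dirichlet_vec])
    then show ?thesis
      using nn_integral_torus_shift[of "\<lambda>y. ennreal (max_dirichlet_vec N y)" "- x"] by simp
  qed
  ultimately show "(\<integral>\<^sup>+y. ennreal (max_dirichlet_vec N (x - y)) \<partial>torus_borel) \<le> ennreal (kernel_const CARD('d) N)"
    and "(\<integral>\<^sup>+y. ennreal (max_dirichlet_vec N (y - x)) \<partial>torus_borel) \<le> ennreal (kernel_const CARD('d) N)"
    using nn_integral_max_dirichlet_vec[of N, where 'd = 'd] by (simp_all add: kernel_const_def)
qed

text \<open>\<open>max_dirichlet_vec\<close> dominates all kernels with index in the box at once, so
  the maximal function is at most its convolution with the modulus of \<open>f\<close>; Tonelli and
  translation invariance finish.\<close>

lemma nn_integral_max_partial_sum_L1: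
  fixes f :: "real ^ 'd \<Rightarrow> complex"
  assumes f: "integrable torus_borel f"
  shows "(\<integral>\<^sup>+x. ennreal (max_partial_sum N f x) \<partial>torus_borel)
    \<le> ennreal (kernel_const CARD('d) N * (\<integral>x. norm (f x) \<partial>torus_borel))"
proof -
  interpret pair_sigma_finite "torus_borel :: (real ^ 'd) measure" "torus_borel :: (real ^ 'd) measure" ..
  have [measurable]: "f \<in> borel_measurable borel"
    using borel_measurable_integrable[OF f] by simp
  have pt: "ennreal (max_partial_sum N f x)
      \<le> (\<integral>\<^sup>+y. ennreal (norm (f y)) * ennreal (max_dirichlet_vec N (x - y)) \<partial>torus_borel)" for x
  proof -
    obtain n where n: "n \<in> index_box N" "max_partial_sum N f x = norm (rect_partial_sum n f x)"
      by (rule max_partial_sum_attained)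
    have "ennreal (max_partial_sum N f x)
        \<le> (\<integral>\<^sup>+y. ennreal (norm (f y * complex_of_real (dirichlet_vec n (x - y)))) \<partial>torus_borel)"
    \<comment> \<open>The Bochner integral of a non-integrable function is zero by convention, so
      that case is trivial.\<close>
    proof (cases "integrable torus_borel (\<lambda>y. f y * complex_of_real (dirichlet_vec n (x - y)))")
      case True
      then show ?thesis
        unfolding n(2) rect_partial_sum_kernel[OF f] by (rule integral_norm_bound_ennreal)
    next
      case False
      then show ?thesis
        unfolding n(2) rect_partial_sum_kernel[OF f] by (simp add: not_integrable_integral_eq)
    qed
    also have "\<dots> \<le> (\<integral>\<^sup>+y. ennreal (norm (f y)) * ennreal (max_dirichlet_vec N (x - y)) \<partial>torus_borel)"
      by (intro nn_integral_mono, subst ennreal_mult[symmetric])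
         (auto simp: norm_mult max_dirichlet_vec_nonneg
           intro!: ennreal_leI mult_left_mono abs_dirichlet_vec_le n)
    finally show ?thesis .
  qed
  have "(\<integral>\<^sup>+x. ennreal (max_partial_sum N f x) \<partial>torus_borel)
    \<le> (\<integral>\<^sup>+x. (\<integral>\<^sup>+y. ennreal (norm (f y)) * ennreal (max_dirichlet_vec N (x - y)) \<partial>torus_borel) \<partial>torus_borel)"
    by (intro nn_integral_mono pt)
  also have "\<dots> = (\<integral>\<^sup>+y. (\<integral>\<^sup>+x. ennreal (norm (f y)) * ennreal (max_dirichlet_vec N (x - y)) \<partial>torus_borel) \<partial>torus_borel)"
    by (rule Fubini'[symmetric]) measurable
  also have "\<dots> \<le> (\<integral>\<^sup>+y. ennreal (norm (f y)) * ennreal (kernel_const CARD('d) N) \<partial>torus_borel)"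
    by (intro nn_integral_mono, subst nn_integral_cmult)
       (auto intro!: mult_left_mono nn_integral_max_dirichlet_vec_shift)
  also have "\<dots> = ennreal (kernel_const CARD('d) N * (\<integral>x. norm (f x) \<partial>torus_borel))"
    using kernel_const_pos[of "CARD('d)" N]
    by (simp add: nn_integral_multc nn_integral_eq_integral f ennreal_mult mult.commute)
  finally show ?thesis .
qed

section \<open>Orthogonality of characters and Bessel's inequality\<close>

lemma integral_character:
  "(\<integral>x. character k x \<partial>torus_borel) = (if k = 0 then 1 else 0)"
proof (cases "k = 0")
  case True
  then show ?thesis by (simp add: character_def freq_dot_def torus_prob.prob_space)
next
  case False
  then obtain j where j: "k $ j \<noteq> 0" by (auto simp: vec_eq_iff)
  \<comment> \<open>Half a period in a direction of nonzero frequency: this translation multiplies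
    the character by -1, so its integral equals its own negative.\<close>
  define h where "h = axis j (pi / of_int (k $ j))"
  have "freq_dot k h = (\<Sum>i\<in>UNIV. if i = j then pi else 0)"
    unfolding freq_dot_def h_def using j by (intro sum.cong) (auto simp: axis_def)
  then have h: "character k h = - 1" by (simp add: character_def)
  have "(\<integral>x. character k x \<partial>torus_borel) = (\<integral>x. character k (x + h) \<partial>torus_borel)"
    by (rule integral_torus_shift[symmetric]) (simp_all add: torus_periodic_character)
  also have "\<dots> = - (\<integral>x. character k x \<partial>torus_borel)"
    by (simp add: character_add h)
  finally show ?thesis using False by simp
qed

lemma character_mult_cnj: "character k x * cnj (character l x) = character (k - l) x"
proof -
  have "freq_dot (k - l) x = freq_dot k x - freq_dot l x"
    by (simp add: freq_dot_def left_diff_distrib sum_subtractf)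
  then show ?thesis
    by (simp add: character_def exp_cnj right_diff_distrib exp_diff exp_minus divide_inverse)
qed

lemma fourier_coeff_character: "fourier_coeff (character k) l = (if k = l then 1 else 0)"
  by (simp add: fourier_coeff_eq character_mult_cnj integral_character)

lemma integrable_character: "integrable torus_borel (character k)"
  by (rule integrable_bounded_torus[of _ 1]) simp_all

lemma fourier_coeff_trig_poly:
  assumes K: "finite K"
  shows "fourier_coeff (\<lambda>x. \<Sum>k\<in>K. b k * character k x) l = (if l \<in> K then b l else 0)"
proof -
  have "fourier_coeff (\<lambda>x. \<Sum>k\<in>K. b k * character k x) l
      = (\<integral>x. (\<Sum>k\<in>K. b k * (character k x * cnj (character l x))) \<partial>torus_borel)"
    by (subst fourier_coeff_eq) (simp_all add: sum_distrib_right mult.assoc)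
  also have "\<dots> = (\<Sum>k\<in>K. b k * fourier_coeff (character k) l)"
    by (subst Bochner_Integration.integral_sum)
       (simp_all add: integrable_fourier_coeff[OF integrable_character] fourier_coeff_eq)
  also have "\<dots> = (if l \<in> K then b l else 0)"
    using K by (simp add: fourier_coeff_character if_distrib[of "(*) _"] cong: if_cong)
  finally show ?thesis .
qed

text \<open>The squared distance of \<open>f\<close> from its Fourier polynomial over
  \<open>K\<close> is nonnegative, and expanding it leaves the difference of the two sides.
  Boundedness makes every product in the expansion integrable; the functions it is applied to are
  truncations.\<close>

lemma bessel_inequality:
  fixes f :: "real ^ 'd \<Rightarrow> complex"
  assumes [measurable]: "f \<in> borel_measurable borel" and b: "\<And>x. norm (f x) \<le> c" and K: "finite K"
  shows "(\<Sum>k\<in>K. (norm (fourier_coeff f k))\<^sup>2) \<le> (\<integral>x. (norm (f x))\<^sup>2 \<partial>torus_borel)"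
proof -
  let ?a = "fourier_coeff f"
  let ?P = "\<lambda>x. \<Sum>k\<in>K. ?a k * character k x"
  have fi: "integrable torus_borel f" by (rule integrable_bounded_torus[OF _ b]) simp
  have bP: "norm (?P x) \<le> (\<Sum>k\<in>K. norm (?a k))" for x
    by (rule order.trans[OF norm_sum]) (simp add: norm_mult)
  have c0: "0 \<le> c" using b[of 0] norm_ge_zero order.trans by blast
  have fP: "(\<integral>x. f x * cnj (?P x) \<partial>torus_borel) = (\<Sum>k\<in>K. ?a k * cnj (?a k))"
  proof -
    have "(\<integral>x. f x * cnj (?P x) \<partial>torus_borel)
        = (\<integral>x. (\<Sum>k\<in>K. cnj (?a k) * (f x * cnj (character k x))) \<partial>torus_borel)"
      by (simp add: sum_distrib_left mult_ac)
    also have "\<dots> = (\<Sum>k\<in>K. cnj (?a k) * ?a k)"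
      by (simp add: integrable_fourier_coeff[OF fi] fourier_coeff_eq)
    finally show ?thesis by (simp add: mult.commute)
  qed
  have coeffP: "fourier_coeff ?P l = (if l \<in> K then ?a l else 0)" for l
    by (rule fourier_coeff_trig_poly[OF K])
  have PP: "(\<integral>x. ?P x * cnj (?P x) \<partial>torus_borel) = (\<Sum>k\<in>K. ?a k * cnj (?a k))"
  proof -
    have Pi: "integrable torus_borel ?P" by (rule integrable_bounded_torus[OF _ bP]) simp
    have "(\<integral>x. ?P x * cnj (?P x) \<partial>torus_borel)
        = (\<integral>x. (\<Sum>k\<in>K. cnj (?a k) * (?P x * cnj (character k x))) \<partial>torus_borel)"
      by (simp add: sum_distrib_left mult_ac)
    also have "\<dots> = (\<Sum>k\<in>K. cnj (?a k) * fourier_coeff ?P k)"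
      by (subst Bochner_Integration.integral_sum)
         (simp_all add: integrable_fourier_coeff[OF Pi] fourier_coeff_eq[of ?P])
    also have "\<dots> = (\<Sum>k\<in>K. cnj (?a k) * ?a k)" by (simp add: coeffP)
    finally show ?thesis by (simp add: mult.commute)
  qed
  let ?s = "\<Sum>k\<in>K. (norm (?a k))\<^sup>2"
  have s: "(\<Sum>k\<in>K. ?a k * cnj (?a k)) = complex_of_real ?s"
    by (simp add: complex_norm_square[symmetric])
  have i1: "integrable torus_borel (\<lambda>x. f x * cnj (f x))"
    by (rule integrable_mult_bounded_torus[OF fi _, of _ c]) (use b in simp_all)
  have i2: "integrable torus_borel (\<lambda>x. f x * cnj (?P x))"
    by (rule integrable_mult_bounded_torus[OF fi]) (simp, use bP in \<open>simp only: complex_mod_cnj\<close>)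
  have i2': "integrable torus_borel (\<lambda>x. cnj (f x * cnj (?P x)))"
    by (rule integrable_cnj[OF i2])
  have i3: "integrable torus_borel (\<lambda>x. ?P x * cnj (?P x))"
    by (rule integrable_mult_bounded_torus[OF integrable_bounded_torus[OF _ bP]])
       (simp, simp, simp only: complex_mod_cnj, rule bP)
  have "complex_of_real (\<integral>x. (norm (f x - ?P x))\<^sup>2 \<partial>torus_borel)
      = (\<integral>x. (f x - ?P x) * cnj (f x - ?P x) \<partial>torus_borel)"
    by (simp only: integral_complex_of_real[symmetric] complex_norm_square[symmetric] of_real_power)
  also have "\<dots> = (\<integral>x. f x * cnj (f x) - f x * cnj (?P x) - cnj (f x * cnj (?P x)) + ?P x * cnj (?P x) \<partial>torus_borel)"
    by (intro Bochner_Integration.integral_cong) (simp_all add: algebra_simps)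
  also have "\<dots> = (\<integral>x. f x * cnj (f x) \<partial>torus_borel) - complex_of_real ?s - cnj (complex_of_real ?s) + complex_of_real ?s"
    by (simp only: Bochner_Integration.integral_add Bochner_Integration.integral_diff
          Bochner_Integration.integrable_diff Bochner_Integration.integral_cnj i1 i2 i2' i3 fP PP s)
  also have "\<dots> = complex_of_real ((\<integral>x. (norm (f x))\<^sup>2 \<partial>torus_borel) - ?s)"
    by (simp add: integral_complex_of_real[symmetric] complex_norm_square[symmetric])
  finally have "(\<integral>x. (norm (f x - ?P x))\<^sup>2 \<partial>torus_borel) = (\<integral>x. (norm (f x))\<^sup>2 \<partial>torus_borel) - ?s"
    by (simp only: of_real_eq_iff)
  moreover have "0 \<le> (\<integral>x. (norm (f x - ?P x))\<^sup>2 \<partial>torus_borel)" by simp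
  ultimately show ?thesis by simp
qed

text \<open>Centered boxes are closed under intersection, and the sides of the intersection are the
  minima. This is what collapses two Dirichlet kernels into one.\<close>

lemma dirichlet_vec_minimum:
  "(\<Sum>k\<in>freq_box n \<inter> freq_box m. character k x)
     = complex_of_real (dirichlet_vec (\<chi> j. min (n $ j) (m $ j)) x)"
proof -
  have "freq_box n \<inter> freq_box m = freq_box (\<chi> j. min (n $ j) (m $ j))"
    by (auto simp: of_nat_min)
  then show ?thesis by (simp only: sum_character_eq_dirichlet_vec)
qed

lemma cnj_sgn_mult: "cnj (sgn z) * z = complex_of_real (norm z)"
proof -
  have "cnj (sgn z) * z = z * cnj z / complex_of_real (norm z)"
    by (simp add: sgn_eq mult.commute)
  also have "z * cnj z = complex_of_real (norm z) * complex_of_real (norm z)"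
    by (simp only: complex_norm_square[symmetric] power2_eq_square of_real_mult)
  finally show ?thesis by simp
qed

text \<open>Ties are broken by the least code under \<open>from_nat\<close>; since the index type is
  countable, this choice is measurable.\<close>

lemma max_partial_sum_selector:
  fixes f :: "real ^ 'd \<Rightarrow> complex"
  obtains s where "s \<in> borel \<rightarrow>\<^sub>M count_space UNIV" "\<And>x. s x \<in> index_box N"
    "\<And>x. max_partial_sum N f x = norm (rect_partial_sum (s x) f x)"
proof -
  define P :: "real ^ 'd \<Rightarrow> nat \<Rightarrow> bool" where "P = (\<lambda>x i. from_nat i \<in> (index_box N :: (nat ^ 'd) set) \<and>
     max_partial_sum N f x = norm (rect_partial_sum (from_nat i) f x))"
  define s where "s = (\<lambda>x. from_nat (LEAST i. P x i) :: nat ^ 'd)"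
  have "P x (LEAST i. P x i)" for x
  proof -
    obtain n where "n \<in> index_box N" "max_partial_sum N f x = norm (rect_partial_sum n f x)"
      by (rule max_partial_sum_attained)
    then have "P x (to_nat n)" by (simp add: P_def)
    then show ?thesis by (rule LeastI)
  qed
  moreover have "s \<in> borel \<rightarrow>\<^sub>M count_space UNIV"
    unfolding s_def P_def by measurable
  ultimately show ?thesis
    by (intro that[of s]) (auto simp: P_def s_def)
qed

text \<open>
  The Kolmogorov--Seliverstov--Plessner argument: linearize the maximum by a measurable choice
  \<open>s\<close> of the index; in the dual expression the products of two Dirichlet kernels collapse to
  the single kernel with the minimal index, so only the first power of the \<open>L\<^sup>1\<close> norm of
  the maximal kernel appears in the square.
\<close>

lemma nn_integral_max_partial_sum_L2:
  fixes f :: "real ^ 'd \<Rightarrow> complex"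
  assumes [measurable]: "f \<in> borel_measurable borel" and b: "\<And>x. norm (f x) \<le> c"
  shows "(\<integral>\<^sup>+x. ennreal (max_partial_sum N f x) \<partial>torus_borel)
    \<le> ennreal (sqrt (kernel_const CARD('d) N * (\<integral>x. (norm (f x))\<^sup>2 \<partial>torus_borel)))"
proof -
  let ?L = "kernel_const CARD('d) N"
  obtain s where s [measurable]: "s \<in> borel \<rightarrow>\<^sub>M count_space UNIV"
    and sN: "\<And>x. s x \<in> index_box N"
    and smax: "\<And>x. max_partial_sum N f x = norm (rect_partial_sum (s x) f x)"
    by (rule max_partial_sum_selector[of N f]) blast
  define K :: "(int ^ 'd) set" where "K = freq_box (\<chi> j. N)"
  have K: "finite K" unfolding K_def by (rule finite_rect_index_set)
  have sub: "freq_box (s x) \<subseteq> K" for x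
    using sN[of x] unfolding K_def index_box_def by (auto intro: order.trans)
  have Sm [measurable]: "(\<lambda>x. rect_partial_sum (s x) f x) \<in> borel_measurable borel"
    by (rule measurable_compose_countable[OF _ s]) measurable
  \<comment> \<open>The conjugate sign turns the modulus into a product; where the partial sum
    vanishes, \<open>sgn\<close> is 0 and the identity still holds.\<close>
  define g where "g = (\<lambda>x. cnj (sgn (rect_partial_sum (s x) f x)))"
  have [measurable]: "g \<in> borel_measurable borel" unfolding g_def by measurable
  have g1: "norm (g x) \<le> 1" for x by (simp add: g_def norm_sgn)
  \<comment> \<open>All dependence on the selected index goes into \<open>u\<close>, so the sums
    below run over the fixed finite set \<open>K\<close> and commute with integration.\<close>
  define u where "u = (\<lambda>k x. if k \<in> freq_box (s x) then g x * character k x else 0)"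
  have [measurable]: "u k \<in> borel_measurable borel" for k
  proof -
    have [measurable]: "Measurable.pred borel (\<lambda>x. k \<in> freq_box (s x))"
      by (rule measurable_compose[OF s]) simp
    show ?thesis unfolding u_def by measurable
  qed
  have u1: "norm (u k x) \<le> 1" for k x
    using g1[of x] by (simp add: u_def norm_mult)
  have ui: "integrable torus_borel (u k)" for k
    by (rule integrable_bounded_torus[OF _ u1]) simp
  define a where "a = fourier_coeff f"
  define e where "e = (\<lambda>k. \<integral>x. u k x \<partial>torus_borel)"
  have max_eq: "complex_of_real (max_partial_sum N f x) = (\<Sum>k\<in>K. a k * u k x)" for x
  proof -
    have "complex_of_real (max_partial_sum N f x) = g x * rect_partial_sum (s x) f x"
      by (simp only: g_def smax cnj_sgn_mult)
    also have "\<dots> = (\<Sum>k\<in>freq_box (s x). a k * u k x)"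
      by (simp add: rect_partial_sum_eq u_def a_def sum_distrib_left mult_ac)
    also have "\<dots> = (\<Sum>k\<in>K. a k * u k x)"
      by (rule sum.mono_neutral_left[OF K sub]) (auto simp: u_def)
    finally show ?thesis .
  qed
  \<comment> \<open>As \<open>e k\<close> is the integral of \<open>u k\<close>, the left side is a
    double integral in which only frequencies common to both boxes survive. Integration in
    \<open>y\<close> gives \<open>?L\<close> uniformly in \<open>x\<close>, and integration in
    \<open>x\<close> is over a probability space.\<close>
  have dual: "(\<Sum>k\<in>K. (norm (e k))\<^sup>2) \<le> ?L"
  proof -
    have pt: "norm (\<Sum>k\<in>K. u k x * cnj (e k)) \<le> ?L" for x
    proof -
      have "(\<Sum>k\<in>K. u k x * cnj (e k)) = (\<integral>y. (\<Sum>k\<in>K. u k x * cnj (u k y)) \<partial>torus_borel)"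
        by (simp add: e_def ui)
      also have "ennreal (norm \<dots>) \<le> (\<integral>\<^sup>+y. ennreal (norm (\<Sum>k\<in>K. u k x * cnj (u k y))) \<partial>torus_borel)"
        by (rule integral_norm_bound_ennreal) (simp add: ui)
      also have "\<dots> \<le> (\<integral>\<^sup>+y. ennreal (max_dirichlet_vec N (x - y)) \<partial>torus_borel)"
      proof (intro nn_integral_mono ennreal_leI)
        fix y
        let ?m = "\<chi> j. min (s x $ j) (s y $ j)"
        have "(\<Sum>k\<in>K. u k x * cnj (u k y)) = (\<Sum>k\<in>freq_box (s x) \<inter> freq_box (s y). u k x * cnj (u k y))"
          by (rule sum.mono_neutral_right[OF K]) (use sub[of x] in \<open>auto simp: u_def\<close>)
        also have "\<dots> = g x * cnj (g y) * complex_of_real (dirichlet_vec ?m (x - y))"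
          unfolding dirichlet_vec_minimum[symmetric] sum_distrib_left
          by (rule sum.cong) (auto simp: u_def character_diff)
        finally have "norm (\<Sum>k\<in>K. u k x * cnj (u k y)) = norm (g x) * norm (g y) * \<bar>dirichlet_vec ?m (x - y)\<bar>"
          by (simp add: norm_mult)
        also have "\<dots> \<le> 1 * \<bar>dirichlet_vec ?m (x - y)\<bar>"
          by (intro mult_right_mono mult_le_one g1) auto
        also have "\<dots> \<le> max_dirichlet_vec N (x - y)"
          using sN[of x] by (simp add: abs_dirichlet_vec_le index_box_def min.coboundedI1)
        finally show "norm (\<Sum>k\<in>K. u k x * cnj (u k y)) \<le> max_dirichlet_vec N (x - y)" .
      qed
      also have "\<dots> \<le> ennreal ?L" by (rule nn_integral_max_dirichlet_vec_shift)
      finally show ?thesis using kernel_const_pos[of "CARD('d)" N] by (simp add: less_imp_le)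
    qed
    have "complex_of_real (\<Sum>k\<in>K. (norm (e k))\<^sup>2) = (\<Sum>k\<in>K. e k * cnj (e k))"
      by (simp only: of_real_sum complex_norm_square)
    also have "\<dots> = (\<integral>x. (\<Sum>k\<in>K. u k x * cnj (e k)) \<partial>torus_borel)"
      by (simp add: e_def ui)
    finally have "\<bar>\<Sum>k\<in>K. (norm (e k))\<^sup>2\<bar> = norm (\<integral>x. (\<Sum>k\<in>K. u k x * cnj (e k)) \<partial>torus_borel)"
      by (metis norm_of_real)
    also have "\<dots> \<le> (\<integral>x. ?L \<partial>(torus_borel :: (real ^ 'd) measure))"
      by (rule Bochner_Integration.integral_norm_bound_integral) (simp_all add: ui pt)
    finally show ?thesis by simp
  qed
  have mi: "integrable torus_borel (max_partial_sum N f)"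
  proof -
    have "integrable torus_borel (\<lambda>x. Re (\<Sum>k\<in>K. a k * u k x))"
      by (intro integrable_Re) (simp add: ui)
    then show ?thesis by (simp add: max_eq[symmetric])
  qed
  have "complex_of_real (\<integral>x. max_partial_sum N f x \<partial>torus_borel) = (\<Sum>k\<in>K. a k * e k)"
    by (simp add: integral_complex_of_real[symmetric] max_eq ui e_def)
  then have "(\<integral>x. max_partial_sum N f x \<partial>torus_borel) \<le> norm (\<Sum>k\<in>K. a k * e k)"
    by (metis abs_ge_self norm_of_real)
  also have "\<dots> \<le> (\<Sum>k\<in>K. norm (a k) * norm (e k))"
    by (rule order.trans[OF norm_sum]) (simp add: norm_mult)
  \<comment> \<open>Cauchy--Schwarz separates the Fourier coefficients, bounded by Bessel's
    inequality, from the \<open>e k\<close>, bounded by \<open>dual\<close>; hence the square root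
    of \<open>?L\<close>.\<close>
  also have "\<dots> \<le> sqrt ((\<Sum>k\<in>K. (norm (a k))\<^sup>2) * (\<Sum>k\<in>K. (norm (e k))\<^sup>2))"
    by (intro real_le_rsqrt Cauchy_Schwarz_ineq_sum)
  also have "\<dots> \<le> sqrt ((\<integral>x. (norm (f x))\<^sup>2 \<partial>torus_borel) * ?L)"
    unfolding a_def
    by (intro real_sqrt_le_mono mult_mono dual bessel_inequality[OF _ b K]) (auto intro: sum_nonneg)
  finally have "(\<integral>x. max_partial_sum N f x \<partial>torus_borel)
      \<le> sqrt (?L * (\<integral>x. (norm (f x))\<^sup>2 \<partial>torus_borel))" by (simp add: mult.commute)
  then show ?thesis
    by (simp add: nn_integral_eq_integral[OF mi] max_partial_sum_nonneg ennreal_leI)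
qed

text \<open>Where the modulus exceeds \<open>t\<close>, its nonpositive power \<open>1 - p\<close>
  is at most that of \<open>t\<close>. The free height stands in for Hoelder's inequality: a bound
  of the Lp norm, taken as \<open>t\<close>, gives twice that bound for the L1 norm.\<close>

lemma norm_le_of_Lp:
  fixes f :: "real ^ 'd \<Rightarrow> complex"
  assumes [measurable]: "f \<in> borel_measurable borel"
    and p: "1 \<le> p" and fp: "integrable torus_borel (\<lambda>x. norm (f x) powr p)" and t: "0 < t"
  shows "integrable torus_borel f"
    and "(\<integral>x. norm (f x) \<partial>torus_borel) \<le> t + t powr (1 - p) * (\<integral>x. norm (f x) powr p \<partial>torus_borel)"
proof -
  have le: "norm (f x) \<le> t + t powr (1 - p) * norm (f x) powr p" for x
  proof (cases "norm (f x) \<le> t")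
    case False
    have "norm (f x) = norm (f x) powr (1 - p) * norm (f x) powr p"
      using False t by (simp flip: powr_add)
    also have "\<dots> \<le> t powr (1 - p) * norm (f x) powr p"
      using False t p by (intro mult_right_mono powr_mono2') auto
    finally show ?thesis using t by simp
  qed (use t in \<open>simp add: add_increasing2\<close>)
  have R: "integrable torus_borel (\<lambda>x. t + t powr (1 - p) * norm (f x) powr p)"
    using fp by simp
  show fi: "integrable torus_borel f"
    by (rule Bochner_Integration.integrable_bound[OF R])
       (use le t in \<open>auto intro!: AE_I2 order.trans[OF le]\<close>)
  have "(\<integral>x. norm (f x) \<partial>torus_borel) \<le> (\<integral>x. t + t powr (1 - p) * norm (f x) powr p \<partial>torus_borel)"
    by (intro integral_mono le R) (use fi in simp)
  then show "(\<integral>x. norm (f x) \<partial>torus_borel) \<le> t + t powr (1 - p) * (\<integral>x. norm (f x) powr p \<partial>torus_borel)"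
    using fp by simp
qed

text \<open>
  Interpolation between the two endpoint bounds: the height \<open>t\<close> of the truncation is chosen so
  that the bounded part and the unbounded part contribute the same amount.
\<close>

lemma nn_integral_max_partial_sum_Lp:
  fixes f :: "real ^ 'd \<Rightarrow> complex"
  assumes [measurable]: "f \<in> borel_measurable borel" and p: "1 \<le> p" "p \<le> 2"
    and fp: "integrable torus_borel (\<lambda>x. norm (f x) powr p)"
    and a: "0 < a" "(\<integral>x. norm (f x) powr p \<partial>torus_borel) \<le> a powr p"
  shows "(\<integral>\<^sup>+x. ennreal (max_partial_sum N f x) \<partial>torus_borel)
    \<le> ennreal (2 * (kernel_const CARD('d) N powr (1 / p) * a))"
proof -
  let ?L = "kernel_const CARD('d) N"
  have L: "0 < ?L" by (rule kernel_const_pos)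
  define t where "t = ?L powr (1 / p) * a"
  have t: "0 < t" using L a by (simp add: t_def)
  \<comment> \<open>The balance condition: by it, the L1 bound L t^(1-p) a^p of the high part and
    the L2 bound, the square root of L t^(2-p) a^p, of the low part both equal \<open>t\<close>. As
    \<open>a\<close> is positive and merely bounds the norm, \<open>t\<close> stays positive when
    \<open>f\<close> vanishes.\<close>
  have tp: "?L * a powr p = t powr p"
    using L a p by (simp add: t_def powr_mult powr_powr)
  define f1 where "f1 = (\<lambda>x. if norm (f x) \<le> t then f x else 0)"
  define f2 where "f2 = (\<lambda>x. if norm (f x) \<le> t then 0 else f x)"
  have [measurable]: "f1 \<in> borel_measurable borel" "f2 \<in> borel_measurable borel"
    unfolding f1_def f2_def by measurable
  have b1: "norm (f1 x) \<le> t" for x using t by (simp add: f1_def)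
  have fi: "integrable torus_borel f" by (rule norm_le_of_Lp[OF _ p(1) fp t]) simp
  have f1i: "integrable torus_borel f1" by (rule integrable_bounded_torus[OF _ b1]) simp
  have f2i: "integrable torus_borel f2"
    by (rule Bochner_Integration.integrable_bound[OF fi]) (auto simp: f2_def)
  have sq: "(norm (f1 x))\<^sup>2 \<le> t powr (2 - p) * norm (f x) powr p" for x
  proof (cases "norm (f x) \<le> t \<and> f x \<noteq> 0")
    case True
    then have "(norm (f1 x))\<^sup>2 = norm (f x) powr (2 - p) * norm (f x) powr p"
      by (simp add: f1_def flip: powr_add powr_numeral)
    also have "\<dots> \<le> t powr (2 - p) * norm (f x) powr p"
      using True p by (intro mult_right_mono powr_mono2) auto
    finally show ?thesis .
  qed (auto simp: f1_def)
  have "(\<integral>x. (norm (f1 x))\<^sup>2 \<partial>torus_borel) \<le> (\<integral>x. t powr (2 - p) * norm (f x) powr p \<partial>torus_borel)"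
    using fp by (intro integral_mono sq)
      (auto intro!: torus_prob.integrable_const_bound[of _ "t\<^sup>2"] AE_I2 power_mono b1)
  also have "\<dots> \<le> t powr (2 - p) * a powr p"
    using a(2) by (simp add: mult_left_mono)
  finally have I1: "?L * (\<integral>x. (norm (f1 x))\<^sup>2 \<partial>torus_borel) \<le> t\<^sup>2"
  proof -
    assume "(\<integral>x. (norm (f1 x))\<^sup>2 \<partial>torus_borel) \<le> t powr (2 - p) * a powr p"
    then have "?L * (\<integral>x. (norm (f1 x))\<^sup>2 \<partial>torus_borel) \<le> ?L * (t powr (2 - p) * a powr p)"
      using L by (intro mult_left_mono) auto
    also have "\<dots> = t powr (2 - p) * t powr p" by (simp only: tp[symmetric] mult_ac)
    also have "\<dots> = t\<^sup>2" using t by (simp flip: powr_add powr_numeral)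
    finally show ?thesis .
  qed
  have lin: "norm (f2 x) \<le> t powr (1 - p) * norm (f x) powr p" for x
  proof (cases "norm (f x) \<le> t")
    case False
    then have "norm (f2 x) = norm (f x) powr (1 - p) * norm (f x) powr p"
      using t by (simp add: f2_def flip: powr_add)
    also have "\<dots> \<le> t powr (1 - p) * norm (f x) powr p"
      using False t p by (intro mult_right_mono powr_mono2') auto
    finally show ?thesis .
  qed (simp add: f2_def)
  have "(\<integral>x. norm (f2 x) \<partial>torus_borel) \<le> (\<integral>x. t powr (1 - p) * norm (f x) powr p \<partial>torus_borel)"
    using fp f2i by (intro integral_mono lin) auto
  also have "\<dots> \<le> t powr (1 - p) * a powr p"
    using a(2) by (simp add: mult_left_mono)
  finally have I2: "?L * (\<integral>x. norm (f2 x) \<partial>torus_borel) \<le> t"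
  proof -
    assume "(\<integral>x. norm (f2 x) \<partial>torus_borel) \<le> t powr (1 - p) * a powr p"
    then have "?L * (\<integral>x. norm (f2 x) \<partial>torus_borel) \<le> ?L * (t powr (1 - p) * a powr p)"
      using L by (intro mult_left_mono) auto
    also have "\<dots> = t powr (1 - p) * t powr p" by (simp only: tp[symmetric] mult_ac)
    also have "\<dots> = t" using t by (simp flip: powr_add)
    finally show ?thesis .
  qed
  have split: "f = (\<lambda>x. f1 x + f2 x)" by (auto simp: f1_def f2_def)
  have "(\<integral>\<^sup>+x. ennreal (max_partial_sum N f x) \<partial>torus_borel)
    \<le> (\<integral>\<^sup>+x. ennreal (max_partial_sum N f1 x) + ennreal (max_partial_sum N f2 x) \<partial>torus_borel)"
    by (subst split, intro nn_integral_mono, subst ennreal_plus[symmetric])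
       (auto simp: max_partial_sum_nonneg intro!: ennreal_leI max_partial_sum_add f1i f2i simp del: ennreal_plus)
  also have "\<dots> = (\<integral>\<^sup>+x. ennreal (max_partial_sum N f1 x) \<partial>torus_borel) + (\<integral>\<^sup>+x. ennreal (max_partial_sum N f2 x) \<partial>torus_borel)"
    by (rule nn_integral_add) auto
  also have "\<dots> \<le> ennreal t + ennreal t"
  proof (rule add_mono)
    have "sqrt (?L * (\<integral>x. (norm (f1 x))\<^sup>2 \<partial>torus_borel)) \<le> t"
      using I1 t by (intro real_le_lsqrt) auto
    then show "(\<integral>\<^sup>+x. ennreal (max_partial_sum N f1 x) \<partial>torus_borel) \<le> ennreal t"
      by (intro order.trans[OF nn_integral_max_partial_sum_L2[of f1 t N] ennreal_leI] b1) simp_all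
    show "(\<integral>\<^sup>+x. ennreal (max_partial_sum N f2 x) \<partial>torus_borel) \<le> ennreal t"
      using order.trans[OF nn_integral_max_partial_sum_L1[OF f2i] ennreal_leI[OF I2]] .
  qed
  also have "\<dots> = ennreal (2 * (?L powr (1 / p) * a))"
    using t by (simp add: t_def mult.commute[of a] flip: ennreal_plus)
  finally show ?thesis .
qed

section \<open>Approximation by Fejer means\<close>

text \<open>As an average of partial sums this is a trigonometric polynomial whatever
  \<open>f\<close> is; the convolution form is recovered in
  \<open>fejer_mean_eq_integral\<close>.\<close>

definition fejer_mean :: "nat \<Rightarrow> (real ^ 'd \<Rightarrow> complex) \<Rightarrow> real ^ 'd \<Rightarrow> complex" where
  "fejer_mean M f x = (\<Sum>n\<in>index_box M. rect_partial_sum n f x) / of_real (real (M + 1) ^ CARD('d))"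

lemma measurable_fejer_mean [measurable]: "fejer_mean M f \<in> borel_measurable borel"
  unfolding fejer_mean_def[abs_def] by measurable

lemma abs_dirichlet_vec_le_prod: "\<bar>dirichlet_vec n x\<bar> \<le> (\<Prod>j\<in>UNIV. 2 * real (n $ j) + 1)"
  unfolding dirichlet_vec_def abs_prod by (intro prod_mono) (simp add: abs_dirichlet_le)

lemma fejer_vec_le: "fejer_vec M x \<le> (2 * real M + 1) ^ CARD('d)" for x :: "real ^ 'd"
proof -
  have "fejer M t \<le> 2 * real M + 1" for t
  proof -
    have "(\<Sum>m\<le>M. dirichlet m t) \<le> (\<Sum>m\<le>M. 2 * real M + 1)"
    proof (rule sum_mono)
      fix m assume "m \<in> {..M}"
      then show "dirichlet m t \<le> 2 * real M + 1"
        using abs_dirichlet_le[of m t] by auto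
    qed
    then show ?thesis unfolding fejer_def by (simp add: pos_divide_le_eq mult.commute)
  qed
  then have "fejer_vec M x \<le> (\<Prod>j\<in>(UNIV :: 'd set). 2 * real M + 1)"
    unfolding fejer_vec_def by (intro prod_mono) (simp add: fejer_nonneg)
  then show ?thesis by simp
qed

lemma integrable_fejer_vec: "integrable torus_borel (fejer_vec M)"
  by (rule torus_prob.integrable_const_bound[of _ "(2 * real M + 1) ^ CARD('a)"])
     (simp_all add: fejer_vec_nonneg fejer_vec_le)

lemma integral_fejer_vec: "(\<integral>x. fejer_vec M x \<partial>torus_borel) = 1"
  by (rule integral_eq_nn_integral[THEN trans])
     (simp_all add: fejer_vec_nonneg nn_integral_fejer_vec)

text \<open>Evenness of the kernel and translation invariance put the shift on \<open>f\<close>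
  instead of the kernel, so that differences of translates, and with them the modulus of continuity,
  appear under the integral.\<close>

lemma fejer_mean_eq_integral:
  fixes f :: "real ^ 'd \<Rightarrow> complex"
  assumes per: "torus_periodic f" and f: "integrable torus_borel f"
  shows "fejer_mean M f x = (\<integral>h. f (h + x) * complex_of_real (fejer_vec M h) \<partial>torus_borel)"
proof -
  have [measurable]: "f \<in> borel_measurable borel"
    using borel_measurable_integrable[OF f] by simp
  have i: "integrable torus_borel (\<lambda>y. f y * complex_of_real (dirichlet_vec n (x - y)))" for n
    by (rule integrable_mult_bounded_torus[OF f, of _ "\<Prod>j\<in>UNIV. 2 * real (n $ j) + 1"])
       (simp_all add: abs_dirichlet_vec_le_prod)
  let ?F = "\<lambda>y. f y * complex_of_real (fejer_vec M (y - x))"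
  have "fejer_mean M f x
      = (\<integral>y. (\<Sum>n\<in>index_box M. f y * complex_of_real (dirichlet_vec n (x - y)))
          / of_real (real (M + 1) ^ CARD('d)) \<partial>torus_borel)"
    unfolding fejer_mean_def rect_partial_sum_kernel[OF f] using i by simp
  also have "\<dots> = (\<integral>y. f y * complex_of_real (fejer_vec M (x - y)) \<partial>torus_borel)"
    by (simp add: fejer_vec_eq sum_distrib_left)
  also have "\<dots> = (\<integral>y. ?F y \<partial>torus_borel)"
    using fejer_vec_minus[of M "x - _"] by simp
  also have "\<dots> = (\<integral>h. ?F (h + x) \<partial>torus_borel)"
  proof (rule integral_torus_shift[symmetric])
    have "fejer_vec M (y + lattice_vec k - x) = fejer_vec M (y - x)" for y k
      using torus_periodicD[OF torus_periodic_fejer_vec, of M "y - x" k] by (simp add: algebra_simps)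
    then show "torus_periodic ?F"
      using per by (simp add: torus_periodic_iff)
  qed simp
  finally show ?thesis by simp
qed

text \<open>The graph of y^p lies above its tangent at \<open>A\<close>; the inequality is that one
  divided by \<open>p\<close>, obtained as Young's inequality with weights 1/p and 1 - 1/p.\<close>

lemma powr_tangent_le:
  fixes y A p :: real
  assumes "1 \<le> p" "0 < A" "0 \<le> y"
  shows "A powr (p - 1) * y \<le> (1 / p) * y powr p + (1 - 1 / p) * A powr p"
proof (cases "y = 0")
  case False
  have "(y powr p) powr (1 / p) * (A powr p) powr (1 - 1 / p) \<le> (1 / p) * y powr p + (1 - 1 / p) * A powr p"
    by (rule Youngs_inequality_0) (use assms False in auto)
  moreover have "p * (1 - 1 / p) = p - 1" using assms by (simp add: field_simps)
  ultimately show ?thesis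
    using assms by (simp add: powr_powr mult.commute)
qed (use assms in auto)

text \<open>Jensen's inequality, by integrating the tangent at the mean of \<open>Y\<close>, which
  has to be positive for the tangent lemma.\<close>

lemma (in prob_space) expectation_powr_le:
  fixes Y :: "'a \<Rightarrow> real"
  assumes p: "1 \<le> p" and Y: "integrable M Y" "integrable M (\<lambda>x. Y x powr p)" "\<And>x. 0 \<le> Y x"
  shows "(expectation Y) powr p \<le> expectation (\<lambda>x. Y x powr p)"
proof (cases "expectation Y = 0")
  case True
  then show ?thesis by simp
next
  case False
  define A where "A = expectation Y"
  have "0 \<le> A" unfolding A_def using Y(3) by simp
  with False have A: "0 < A" by (simp add: A_def)
  have "(\<integral>x. A powr (p - 1) * Y x \<partial>M) \<le> (\<integral>x. (1 / p) * Y x powr p + (1 - 1 / p) * A powr p \<partial>M)"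
    by (intro integral_mono powr_tangent_le p A Y) (simp_all add: Y)
  then have "A powr (p - 1) * A \<le> (1 / p) * expectation (\<lambda>x. Y x powr p) + (1 - 1 / p) * A powr p"
    using Y by (simp add: A_def prob_space)
  moreover have "A powr (p - 1) * A = A powr p"
    using A by (simp add: powr_diff)
  ultimately have "(1 / p) * A powr p \<le> (1 / p) * expectation (\<lambda>x. Y x powr p)"
    by (simp add: algebra_simps)
  then show ?thesis using p by (simp add: A_def divide_right_mono pos_divide_le_eq field_simps)
qed

lemma norm_diff_powr_le:
  fixes a b :: "'a :: real_normed_vector"
  assumes "1 \<le> p"
  shows "norm (a - b) powr p \<le> 2 powr p * (norm a powr p + norm b powr p)"
proof -
  have "norm (a - b) powr p \<le> (2 * max (norm a) (norm b)) powr p"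
    using assms norm_triangle_ineq4[of a b] by (intro powr_mono2) auto
  also have "\<dots> = 2 powr p * max (norm a) (norm b) powr p"
    by (rule powr_mult)
  also have "max (norm a) (norm b) powr p \<le> norm a powr p + norm b powr p"
    by (simp add: max_def)
  finally show ?thesis by simp
qed

lemma integrable_diff_powr:
  fixes f g :: "real ^ 'd \<Rightarrow> complex"
  assumes [measurable]: "f \<in> borel_measurable borel" "g \<in> borel_measurable borel" and p: "1 \<le> p"
    and "integrable torus_borel (\<lambda>x. norm (f x) powr p)" "integrable torus_borel (\<lambda>x. norm (g x) powr p)"
  shows "integrable torus_borel (\<lambda>x. norm (f x - g x) powr p)"
  by (rule Bochner_Integration.integrable_bound
      [where f = "\<lambda>x. 2 powr p * (norm (f x) powr p + norm (g x) powr p)"])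
     (use assms(4,5) norm_diff_powr_le[OF p] in auto)

text \<open>The third bound is uniform in \<open>h\<close> and serves twice: it makes the supremum
  in \<open>modulus_of_continuity\<close> a bounded one, and it controls the far part of the Fejer
  kernel, where no smoothness is available.\<close>

lemma
  fixes f :: "real ^ 'd \<Rightarrow> complex"
  assumes per: "torus_periodic f" and [measurable]: "f \<in> borel_measurable borel"
    and p: "1 \<le> p" and fp: "integrable torus_borel (\<lambda>x. norm (f x) powr p)"
  shows integrable_shift_powr: "integrable torus_borel (\<lambda>x. norm (f (x + h)) powr p)"
    and integrable_shift_diff_powr: "integrable torus_borel (\<lambda>x. norm (f (x + h) - f x) powr p)"
    and integral_shift_diff_powr_le: "(\<integral>x. norm (f (x + h) - f x) powr p \<partial>torus_borel)
      \<le> 2 powr p * (2 * (\<integral>x. norm (f x) powr p \<partial>torus_borel))"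
proof -
  have perp: "torus_periodic (\<lambda>x. norm (f x) powr p)" by (rule torus_periodic_comp[OF per])
  show shift_p: "integrable torus_borel (\<lambda>x. norm (f (x + h)) powr p)"
    using integrable_torus_shift_iff[OF _ perp, of h] fp by simp
  show gi: "integrable torus_borel (\<lambda>x. norm (f (x + h) - f x) powr p)"
    by (rule integrable_diff_powr[OF _ _ p shift_p fp]) simp_all
  have "(\<integral>x. norm (f (x + h) - f x) powr p \<partial>torus_borel)
      \<le> (\<integral>x. 2 powr p * (norm (f (x + h)) powr p + norm (f x) powr p) \<partial>torus_borel)"
    by (intro integral_mono gi norm_diff_powr_le p) (simp add: shift_p fp)
  also have "\<dots> = 2 powr p * (2 * (\<integral>x. norm (f x) powr p \<partial>torus_borel))"
    using integral_torus_shift[OF _ perp, of h] by (simp add: shift_p fp)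
  finally show "(\<integral>x. norm (f (x + h) - f x) powr p \<partial>torus_borel)
      \<le> 2 powr p * (2 * (\<integral>x. norm (f x) powr p \<partial>torus_borel))" .
qed

text \<open>Where the \<open>j\<close>-th coordinate is far from 0, that factor is replaced by a
  constant and the others are kept whole. The majorant is still a product, and its remaining factors
  have mass one.\<close>

lemma nn_integral_fejer_vec_tail:
  "(\<integral>\<^sup>+h. (\<Prod>i\<in>UNIV. if i = j then ennreal \<epsilon> else ennreal (fejer M (h $ i))) \<partial>torus_borel) = ennreal \<epsilon>"
proof -
  let ?\<phi> = "\<lambda>i t. if i = j then ennreal \<epsilon> else ennreal (fejer M t)"
  have "(\<integral>\<^sup>+h. (\<Prod>i\<in>UNIV. ?\<phi> i (h $ i)) \<partial>torus_borel) = (\<Prod>i\<in>UNIV. \<integral>\<^sup>+t. ?\<phi> i t \<partial>circle_borel)"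
    by (rule nn_integral_torus_prod) measurable
  also have "\<dots> = (\<Prod>i\<in>UNIV. if i = j then ennreal \<epsilon> else 1)"
    by (intro prod.cong) (auto simp: nn_integral_fejer emeasure_circle_borel_UNIV)
  finally show ?thesis by (simp add: prod.delta)
qed

text \<open>
  The crude kernel tail bound suffices, at the price of taking \<open>M\<close> polynomially large in \<open>1 / \<delta>\<close>:
  only logarithms of \<open>M\<close> enter the maximal inequality.
\<close>

lemma fejer_mean_approx:
  fixes f :: "real ^ 'd \<Rightarrow> complex"
  assumes per: "torus_periodic f" and [measurable]: "f \<in> borel_measurable borel"
    and p: "1 \<le> p" and fp: "integrable torus_borel (\<lambda>x. norm (f x) powr p)"
    and \<delta>: "0 < \<delta>" and W: "0 \<le> W"
    and small: "\<And>h. torus_norm h \<le> \<delta> \<Longrightarrow> (\<integral>x. norm (f (x + h) - f x) powr p \<partial>torus_borel) \<le> W"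
  shows "integrable torus_borel (\<lambda>x. norm (f x - fejer_mean M f x) powr p)"
    and "(\<integral>x. norm (f x - fejer_mean M f x) powr p \<partial>torus_borel)
      \<le> W + 2 powr p * (2 * (\<integral>x. norm (f x) powr p \<partial>torus_borel))
            * (real CARD('d) * (pi\<^sup>2 / (real (M + 1) * \<delta>\<^sup>2)))"
proof -
  interpret pair_sigma_finite "torus_borel :: (real ^ 'd) measure" "torus_borel :: (real ^ 'd) measure" ..
  define C where "C = 2 powr p * (2 * (\<integral>x. norm (f x) powr p \<partial>torus_borel))"
  define \<epsilon> where "\<epsilon> = pi\<^sup>2 / (real (M + 1) * \<delta>\<^sup>2)"
  have C0: "0 \<le> C" unfolding C_def by simp
  have e0: "0 \<le> \<epsilon>" unfolding \<epsilon>_def by simp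
  have fi: "integrable torus_borel f" by (rule norm_le_of_Lp[OF _ p fp zero_less_one]) simp
  note shift_p = integrable_shift_powr[OF per _ p fp]
  have shift_i: "integrable torus_borel (\<lambda>x. f (x + h))" for h
    using integrable_torus_shift_iff[OF _ per, of h] fi by simp
  define g where "g = (\<lambda>h. \<integral>x. norm (f (x + h) - f x) powr p \<partial>torus_borel)"
  note gi = integrable_shift_diff_powr[OF per _ p fp]
  have g0: "0 \<le> g h" for h unfolding g_def by simp
  have gC: "g h \<le> C" for h
    unfolding g_def C_def by (rule integral_shift_diff_powr_le[OF per _ p fp]) simp
  have pt: "ennreal (norm (f x - fejer_mean M f x) powr p)
      \<le> (\<integral>\<^sup>+h. ennreal (fejer_vec M h) * ennreal (norm (f (x + h) - f x) powr p) \<partial>torus_borel)" for x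
  proof -
    let ?w = "fejer_vec M :: real ^ 'd \<Rightarrow> real"
    \<comment> \<open>The kernel is a probability density, so for fixed \<open>x\<close> Jensen's
      inequality takes the power \<open>p\<close> inside the average over \<open>h\<close>.\<close>
    let ?Q = "density torus_borel (\<lambda>h. ennreal (?w h))"
    let ?Y = "\<lambda>h. norm (f (x + h) - f x)"
    interpret Q: prob_space ?Q
    proof
      show "emeasure ?Q (space ?Q) = 1"
        using nn_integral_fejer_vec[of M, where 'd = 'd] by (simp add: emeasure_density)
    qed
    have wb: "norm (complex_of_real (?w h)) \<le> (2 * real M + 1) ^ CARD('d)" for h
      using fejer_vec_nonneg[of M h] fejer_vec_le[of M h] by simp
    have di: "integrable torus_borel (\<lambda>h. f (x + h) - f x)"
      using shift_i[of x] by (simp add: add.commute)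
    have dwi: "integrable torus_borel (\<lambda>h. (f (x + h) - f x) * complex_of_real (?w h))"
      by (rule integrable_mult_bounded_torus[OF di _ wb]) simp
    have fwi: "integrable torus_borel (\<lambda>h. f (x + h) * complex_of_real (?w h))"
      by (rule integrable_mult_bounded_torus[OF _ _ wb]) (use shift_i[of x] in \<open>simp_all add: add.commute\<close>)
    have cw: "(\<integral>h. f x * complex_of_real (?w h) \<partial>torus_borel) = f x"
      by (simp add: integral_fejer_vec)
    have "fejer_mean M f x - f x = (\<integral>h. (f (x + h) - f x) * complex_of_real (?w h) \<partial>torus_borel)"
      using fwi cw integrable_fejer_vec[of M, where 'a = 'd]
      by (simp add: fejer_mean_eq_integral[OF per fi] add.commute[of _ x] left_diff_distrib)
    then have "norm (f x - fejer_mean M f x) = norm (\<integral>h. (f (x + h) - f x) * complex_of_real (?w h) \<partial>torus_borel)"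
      by (metis norm_minus_commute)
    also have "\<dots> \<le> (\<integral>h. norm ((f (x + h) - f x) * complex_of_real (?w h)) \<partial>torus_borel)"
      by (rule integral_norm_bound)
    also have "\<dots> = Q.expectation ?Y"
      by (subst integral_density) (simp_all add: fejer_vec_nonneg norm_mult mult.commute)
    finally have 1: "norm (f x - fejer_mean M f x) \<le> Q.expectation ?Y" .
    have Yi: "integrable ?Q ?Y"
      using integrable_norm[OF dwi]
      by (subst integrable_density) (simp_all add: fejer_vec_nonneg norm_mult mult.commute)
    have Ypb: "integrable torus_borel (\<lambda>h. ?Y h powr p)"
      by (rule integrable_diff_powr[OF _ _ p]) (use shift_p[of x] in \<open>simp_all add: add.commute\<close>)
    have Ypw: "integrable torus_borel (\<lambda>h. ?w h * ?Y h powr p)"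
    proof (rule Bochner_Integration.integrable_bound)
      show "integrable torus_borel (\<lambda>h. (2 * real M + 1) ^ CARD('d) * ?Y h powr p)"
        using Ypb by simp
    qed (auto simp: fejer_vec_nonneg fejer_vec_le abs_mult intro!: AE_I2 mult_right_mono)
    have Ypi: "integrable ?Q (\<lambda>h. ?Y h powr p)"
      using Ypw by (subst integrable_density) (simp_all add: fejer_vec_nonneg)
    have "norm (f x - fejer_mean M f x) powr p \<le> (Q.expectation ?Y) powr p"
      using 1 p by (intro powr_mono2) auto
    also have "\<dots> \<le> Q.expectation (\<lambda>h. ?Y h powr p)"
      by (rule Q.expectation_powr_le[OF p Yi Ypi]) simp
    also have "\<dots> = (\<integral>h. ?w h * ?Y h powr p \<partial>torus_borel)"
      by (subst integral_density) (simp_all add: fejer_vec_nonneg)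
    finally have "ennreal (norm (f x - fejer_mean M f x) powr p)
        \<le> ennreal (\<integral>h. ?w h * ?Y h powr p \<partial>torus_borel)" by (rule ennreal_leI)
    also have "\<dots> = (\<integral>\<^sup>+h. ennreal (?w h * ?Y h powr p) \<partial>torus_borel)"
      by (rule nn_integral_eq_integral[symmetric, OF Ypw]) (simp add: fejer_vec_nonneg)
    also have "\<dots> = (\<integral>\<^sup>+h. ennreal (?w h) * ennreal (?Y h powr p) \<partial>torus_borel)"
      by (simp add: ennreal_mult fejer_vec_nonneg)
    finally show ?thesis .
  qed
  let ?tail = "\<lambda>j (h :: real ^ 'd). \<Prod>i\<in>UNIV. if i = j then ennreal \<epsilon> else ennreal (fejer M (h $ i))"
  \<comment> \<open>Near 0 the bound \<open>W\<close> applies. Far from 0 some coordinate exceeds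
    \<delta>, and summing the majorants over all \<open>j\<close> avoids singling it out; there
    \<open>g\<close> has only the uniform bound \<open>C\<close>.\<close>
  have tail: "ennreal (fejer_vec M h) * ennreal (g h)
      \<le> ennreal W * ennreal (fejer_vec M h) + ennreal C * (\<Sum>j\<in>UNIV. ?tail j h)" for h
  proof (cases "torus_norm h \<le> \<delta>")
    case True
    have "ennreal (fejer_vec M h) * ennreal (g h) \<le> ennreal (fejer_vec M h) * ennreal W"
      by (intro mult_left_mono ennreal_leI) (simp_all add: g_def small[OF True])
    then show ?thesis by (simp add: mult.commute add_increasing2)
  next
    case False
    then obtain j where j: "\<delta> < torus_abs (h $ j)"
      unfolding torus_norm_def by (subst (asm) Max_le_iff) (auto simp: not_le)
    have "ennreal (fejer_vec M h) = (\<Prod>i\<in>UNIV. ennreal (fejer M (h $ i)))"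
      by (simp add: fejer_vec_def prod_ennreal fejer_nonneg)
    also have "\<dots> \<le> ?tail j h"
      using fejer_tail[OF \<delta> j, of M]
      by (intro prod_mono_ennreal) (auto simp: \<epsilon>_def intro!: ennreal_leI)
    also have "\<dots> \<le> (\<Sum>j\<in>UNIV. ?tail j h)"
      by (rule member_le_sum) auto
    finally have "ennreal (fejer_vec M h) * ennreal (g h) \<le> (\<Sum>j\<in>UNIV. ?tail j h) * ennreal C"
      by (intro mult_mono ennreal_leI gC) auto
    then show ?thesis by (simp add: mult.commute add_increasing)
  qed
  have "(\<integral>\<^sup>+x. ennreal (norm (f x - fejer_mean M f x) powr p) \<partial>torus_borel)
    \<le> (\<integral>\<^sup>+x. (\<integral>\<^sup>+h. ennreal (fejer_vec M h) * ennreal (norm (f (x + h) - f x) powr p) \<partial>torus_borel) \<partial>torus_borel)"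
    by (intro nn_integral_mono pt)
  also have "\<dots> = (\<integral>\<^sup>+h. (\<integral>\<^sup>+x. ennreal (fejer_vec M h) * ennreal (norm (f (x + h) - f x) powr p) \<partial>torus_borel) \<partial>torus_borel)"
    by (rule Fubini'[symmetric]) measurable
  also have "\<dots> = (\<integral>\<^sup>+h. ennreal (fejer_vec M h) * ennreal (g h) \<partial>torus_borel)"
    by (simp add: nn_integral_cmult nn_integral_eq_integral gi g_def)
  also have "\<dots> \<le> (\<integral>\<^sup>+h. ennreal W * ennreal (fejer_vec M h) + ennreal C * (\<Sum>j\<in>UNIV. ?tail j h) \<partial>torus_borel)"
    by (intro nn_integral_mono tail)
  also have "\<dots> = ennreal W + ennreal C * (\<Sum>j\<in>(UNIV :: 'd set). ennreal \<epsilon>)"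
    by (simp add: nn_integral_add nn_integral_cmult nn_integral_sum nn_integral_fejer_vec
        nn_integral_fejer_vec_tail)
  also have "\<dots> = ennreal (W + C * (real CARD('d) * \<epsilon>))"
    using W C0 e0 by (simp add: ennreal_mult ennreal_of_nat_eq_real_of_nat)
  finally have bound: "(\<integral>\<^sup>+x. ennreal (norm (f x - fejer_mean M f x) powr p) \<partial>torus_borel)
     \<le> ennreal (W + C * (real CARD('d) * \<epsilon>))" .
  show int: "integrable torus_borel (\<lambda>x. norm (f x - fejer_mean M f x) powr p)"
    by (rule integrableI_bounded) (use bound in \<open>auto simp: le_less_trans\<close>)
  have "ennreal (\<integral>x. norm (f x - fejer_mean M f x) powr p \<partial>torus_borel) \<le> ennreal (W + C * (real CARD('d) * \<epsilon>))"
    using bound by (simp add: nn_integral_eq_integral[OF int])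
  then show "(\<integral>x. norm (f x - fejer_mean M f x) powr p \<partial>torus_borel)
      \<le> W + 2 powr p * (2 * (\<integral>x. norm (f x) powr p \<partial>torus_borel))
            * (real CARD('d) * (pi\<^sup>2 / (real (M + 1) * \<delta>\<^sup>2)))"
    unfolding C_def[symmetric] \<epsilon>_def[symmetric]
    using W C0 e0 by (subst (asm) ennreal_le_iff) (auto intro!: add_nonneg_nonneg mult_nonneg_nonneg)
qed

section \<open>Almost everywhere convergence\<close>

lemma rect_partial_sum_trig_poly:
  fixes b :: "int ^ 'd \<Rightarrow> complex"
  assumes K: "finite K"
  shows "rect_partial_sum m (\<lambda>x. \<Sum>k\<in>K. b k * character k x) x
    = (\<Sum>k\<in>freq_box m \<inter> K. b k * character k x)"
  by (simp add: rect_partial_sum_eq fourier_coeff_trig_poly[OF K] sum.inter_restrict finite_rect_index_set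
      if_distrib[of "\<lambda>c. c * _"] cong: if_cong)

lemma fejer_mean_trig_poly:
  fixes f :: "real ^ 'd \<Rightarrow> complex"
  obtains b where "fejer_mean M f = (\<lambda>x. \<Sum>k\<in>freq_box (\<chi> j. M). b k * character k x)"
proof
  define c where "c = complex_of_real (real (M + 1) ^ CARD('d))"
  define b where "b = (\<lambda>k. \<Sum>n\<in>index_box M. if k \<in> freq_box n then fourier_coeff f k / c else 0)"
  show "fejer_mean M f = (\<lambda>x. \<Sum>k\<in>freq_box (\<chi> j. M). b k * character k x)"
  proof
    fix x
    have *: "rect_partial_sum n f x / c
        = (\<Sum>k\<in>freq_box (\<chi> j. M). (if k \<in> freq_box n then fourier_coeff f k / c else 0) * character k x)"
      if n: "n \<in> index_box M" for n
    proof -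
      have "rect_partial_sum n f x / c = (\<Sum>k\<in>freq_box n. fourier_coeff f k / c * character k x)"
        by (simp add: rect_partial_sum_eq sum_divide_distrib)
      also have "\<dots> = (\<Sum>k\<in>freq_box n. (if k \<in> freq_box n then fourier_coeff f k / c else 0) * character k x)"
        by (intro sum.cong) auto
      also have "\<dots> = (\<Sum>k\<in>freq_box (\<chi> j. M). (if k \<in> freq_box n then fourier_coeff f k / c else 0) * character k x)"
      proof (rule sum.mono_neutral_left)
        show "freq_box n \<subseteq> freq_box (\<chi> j. M)"
          using n unfolding index_box_def by (auto intro: order.trans)
      qed (rule finite_rect_index_set, auto)
      finally show ?thesis .
    qed
    have "fejer_mean M f x = (\<Sum>n\<in>index_box M. rect_partial_sum n f x / c)"
      by (simp add: fejer_mean_def c_def sum_divide_distrib)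
    also have "\<dots> = (\<Sum>n\<in>index_box M. \<Sum>k\<in>freq_box (\<chi> j. M).
        (if k \<in> freq_box n then fourier_coeff f k / c else 0) * character k x)"
      by (intro sum.cong refl *)
    also have "\<dots> = (\<Sum>k\<in>freq_box (\<chi> j. M). b k * character k x)"
      unfolding b_def sum_distrib_right by (rule sum.swap)
    finally show "fejer_mean M f x = (\<Sum>k\<in>freq_box (\<chi> j. M). b k * character k x)" .
  qed
qed

lemma rect_partial_sum_fejer_mean:
  assumes "\<And>j. M \<le> m $ j"
  shows "rect_partial_sum m (fejer_mean M f) x = fejer_mean M f x"
proof -
  obtain b where b: "fejer_mean M f = (\<lambda>x. \<Sum>k\<in>freq_box (\<chi> j. M). b k * character k x)"
    by (rule fejer_mean_trig_poly)
  have "freq_box m \<inter> freq_box (\<chi> j. M) = freq_box (\<chi> j. M)"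
    using assms by (auto intro: order.trans)
  then show ?thesis
    unfolding b by (simp only: rect_partial_sum_trig_poly[OF finite_rect_index_set])
qed

text \<open>The mean has no frequencies beyond \<open>N\<close>, so enlarging a side past
  \<open>N\<close> changes nothing. Hence the finite maximum over \<open>index_box N\<close>
  controls every rectangle, however unequal its sides.\<close>

lemma rect_partial_sum_fejer_mean_min:
  assumes "M \<le> N"
  shows "rect_partial_sum m (fejer_mean M f) x = rect_partial_sum (\<chi> j. min (m $ j) N) (fejer_mean M f) x"
proof -
  obtain b where b: "fejer_mean M f = (\<lambda>x. \<Sum>k\<in>freq_box (\<chi> j. M). b k * character k x)"
    by (rule fejer_mean_trig_poly)
  have "freq_box m \<inter> freq_box (\<chi> j. M) = freq_box (\<chi> j. min (m $ j) N) \<inter> freq_box (\<chi> j. M)"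
    using assms by (auto simp: of_nat_min intro: order.trans)
  then show ?thesis
    unfolding b by (simp only: rect_partial_sum_trig_poly[OF finite_rect_index_set])
qed

lemma integrable_fejer_mean: "integrable torus_borel (fejer_mean M f)"
proof -
  obtain b where b: "fejer_mean M f = (\<lambda>x. \<Sum>k\<in>freq_box (\<chi> j. M). b k * character k x)"
    by (rule fejer_mean_trig_poly)
  show ?thesis unfolding b by (simp add: integrable_character)
qed

lemma AE_summable_of_nn_integral_bound:
  fixes V :: "nat \<Rightarrow> 'a \<Rightarrow> real"
  assumes [measurable]: "\<And>j. V j \<in> borel_measurable M" and V0: "\<And>j x. 0 \<le> V j x"
    and V: "\<And>j. (\<integral>\<^sup>+x. ennreal (V j x) \<partial>M) \<le> ennreal (b j)"
    and b: "summable b" "\<And>j. 0 \<le> b j"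
  shows "AE x in M. summable (\<lambda>j. V j x)"
proof -
  have "(\<integral>\<^sup>+x. (\<Sum>j. ennreal (V j x)) \<partial>M) = (\<Sum>j. \<integral>\<^sup>+x. ennreal (V j x) \<partial>M)"
    by (rule nn_integral_suminf) measurable
  also have "\<dots> \<le> (\<Sum>j. ennreal (b j))"
    by (intro suminf_le V) auto
  also have "\<dots> = ennreal (\<Sum>j. b j)"
    by (rule suminf_ennreal2[OF b(2,1)])
  finally have "(\<integral>\<^sup>+x. (\<Sum>j. ennreal (V j x)) \<partial>M) \<noteq> \<infinity>"
    by (auto simp: top_unique)
  then have "AE x in M. (\<Sum>j. ennreal (V j x)) \<noteq> \<infinity>"
    by (intro nn_integral_noteq_infinite) measurable
  then show ?thesis
    by eventually_elim (auto intro: summable_suminf_not_top V0)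
qed

text \<open>The convergence mechanism, separated from smoothness: only the rates \<open>a j\<close>
  enter. Weighted summability makes the blocks summable at almost every point, uniformly in the
  rectangle; plain summability makes the means converge along \<open>M\<close>.\<close>

theorem AE_pringsheim_of_fejer_mean_bounds:
  fixes f :: "real ^ 'd \<Rightarrow> complex" and M :: "nat \<Rightarrow> nat"
  assumes [measurable]: "f \<in> borel_measurable borel" and p: "1 \<le> p" "p \<le> 2"
    and fp: "integrable torus_borel (\<lambda>x. norm (f x) powr p)"
    and M: "incseq M" "\<And>i. \<exists>j. i \<le> M j"
    and a: "\<And>j. 0 < a j" "summable a"
    and approx_i: "\<And>j. integrable torus_borel (\<lambda>x. norm (f x - fejer_mean (M j) f x) powr p)"
    and approx: "\<And>j. (\<integral>x. norm (f x - fejer_mean (M j) f x) powr p \<partial>torus_borel) \<le> a j powr p"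
    and sb: "summable (\<lambda>j. kernel_const CARD('d) (M (Suc j)) powr (1 / p) * (a j + a (Suc j)))"
  shows "AE x in torus_borel. ((\<lambda>n. rect_partial_sum n f x) \<longlongrightarrow> f x) pringsheim"
proof -
  let ?L = "\<lambda>j. kernel_const CARD('d) (M (Suc j)) powr (1 / p)"
  define r where "r = (\<lambda>j x. f x - fejer_mean (M j) f x)"
  have [measurable]: "r j \<in> borel_measurable borel" for j unfolding r_def by measurable
  have fi: "integrable torus_borel f" by (rule norm_le_of_Lp[OF _ p(1) fp zero_less_one]) simp
  have ri: "integrable torus_borel (r j)" for j
    unfolding r_def by (intro Bochner_Integration.integrable_diff fi integrable_fejer_mean)
  have rp: "integrable torus_borel (\<lambda>x. norm (r j x) powr p)"
    "(\<integral>x. norm (r j x) powr p \<partial>torus_borel) \<le> a j powr p" for j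
    using approx_i approx by (simp_all add: r_def)
  \<comment> \<open>The block between two consecutive means is a difference of two remainders, hence
    two summands. The first alone also bounds the partial sums of \<open>r j\<close> inside
    \<open>M (Suc j)\<close>, which the end of the chain uses.\<close>
  define V where "V = (\<lambda>j x. max_partial_sum (M (Suc j)) (r j) x + max_partial_sum (M (Suc j)) (r (Suc j)) x)"
  have V0: "0 \<le> V j x" for j x unfolding V_def by (simp add: max_partial_sum_nonneg)
  have "AE x in torus_borel. summable (\<lambda>j. V j x)"
  proof (rule AE_summable_of_nn_integral_bound[where b = "\<lambda>j. 2 * (?L j * (a j + a (Suc j)))"])
    fix j
    have "(\<integral>\<^sup>+x. ennreal (V j x) \<partial>torus_borel)
      = (\<integral>\<^sup>+x. ennreal (max_partial_sum (M (Suc j)) (r j) x) \<partial>torus_borel)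
        + (\<integral>\<^sup>+x. ennreal (max_partial_sum (M (Suc j)) (r (Suc j)) x) \<partial>torus_borel)"
      unfolding V_def by (simp add: max_partial_sum_nonneg nn_integral_add)
    also have "\<dots> \<le> ennreal (2 * (?L j * a j)) + ennreal (2 * (?L j * a (Suc j)))"
      by (intro add_mono nn_integral_max_partial_sum_Lp p rp a) simp_all
    also have "\<dots> = ennreal (2 * (?L j * (a j + a (Suc j))))"
      using a(1)[of j] a(1)[of "Suc j"]
      by (subst ennreal_plus[symmetric]) (auto simp: algebra_simps)
    finally show "(\<integral>\<^sup>+x. ennreal (V j x) \<partial>torus_borel) \<le> ennreal (2 * (?L j * (a j + a (Suc j))))" .
    show "0 \<le> 2 * (?L j * (a j + a (Suc j)))"
      using a(1)[of j] a(1)[of "Suc j"] by simp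
  qed (use V0 sb in \<open>auto simp: V_def intro: summable_mult\<close>)
  moreover have "AE x in torus_borel. summable (\<lambda>j. norm (r j x))"
  proof (rule AE_summable_of_nn_integral_bound[where b = "\<lambda>j. 2 * a j"])
    fix j
    have "(\<integral>x. norm (r j x) \<partial>torus_borel) \<le> a j + a j powr (1 - p) * (\<integral>x. norm (r j x) powr p \<partial>torus_borel)"
      by (rule norm_le_of_Lp(2)[OF _ p(1) rp(1) a(1)]) simp
    also have "\<dots> \<le> a j + a j powr (1 - p) * a j powr p"
      by (intro add_left_mono mult_left_mono rp) simp
    also have "\<dots> = 2 * a j"
      using a(1)[of j] by (simp flip: powr_add)
    finally show "(\<integral>\<^sup>+x. ennreal (norm (r j x)) \<partial>torus_borel) \<le> ennreal (2 * a j)"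
      by (simp add: nn_integral_eq_integral ri ennreal_leI)
    show "0 \<le> 2 * a j" using a(1)[of j] by simp
  qed (use a(2) in \<open>auto intro: summable_mult\<close>)
  ultimately show ?thesis
  proof eventually_elim
    case (elim x)
    have step: "norm (rect_partial_sum m (fejer_mean (M (Suc j)) f) x - rect_partial_sum m (fejer_mean (M j) f) x)
        \<le> V j x" for m j
    proof -
      let ?m = "\<chi> i. min (m $ i) (M (Suc j))"
      have m: "?m \<in> index_box (M (Suc j))" by (simp add: index_box_def)
      have "rect_partial_sum m (fejer_mean (M (Suc j)) f) x - rect_partial_sum m (fejer_mean (M j) f) x
        = rect_partial_sum ?m (r j) x - rect_partial_sum ?m (r (Suc j)) x"
        unfolding r_def rect_partial_sum_diff[OF fi integrable_fejer_mean]
        using rect_partial_sum_fejer_mean_min[of "M j" "M (Suc j)" m f x] incseq_SucD[OF M(1), of j]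
          rect_partial_sum_fejer_mean_min[of "M (Suc j)" "M (Suc j)" m f x]
        by simp
      then show ?thesis
        unfolding V_def using m
        by (auto intro!: order.trans[OF norm_triangle_ineq4] add_mono norm_rect_partial_sum_le_max)
    qed
    have tele: "norm (rect_partial_sum m (fejer_mean (M (J + i)) f) x - rect_partial_sum m (fejer_mean (M J) f) x)
        \<le> (\<Sum>j=J..<J + i. V j x)" for m J i
    proof (induction i)
      case (Suc i)
      show ?case
        using norm_triangle_le[OF add_mono[OF step[of m "J + i"] Suc]] by simp
    qed simp
    show ?case
    proof (rule tendstoI)
      fix e :: real assume e: "0 < e"
      obtain J1 where J1: "\<And>m n. m \<ge> J1 \<Longrightarrow> norm (\<Sum>j=m..<n. V j x) < e / 2"
        using elim(1) e unfolding summable_Cauchy by (meson half_gt_zero)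
      have "(\<lambda>j. norm (r j x)) \<longlonglongrightarrow> 0" by (rule summable_LIMSEQ_zero[OF elim(2)])
      then have "\<forall>\<^sub>F j in sequentially. norm (r j x) < e / 2"
        using e by (intro order_tendstoD) auto
      then obtain J2 where J2: "\<And>j. j \<ge> J2 \<Longrightarrow> norm (r j x) < e / 2"
        by (auto simp: eventually_sequentially)
      define J where "J = max J1 J2"
      have main: "dist (rect_partial_sum n f x) (f x) < e" if n: "M J \<le> Min (range (\<lambda>j. n $ j))" for n
      proof -
        have nJ: "M J \<le> n $ j" for j using n by (meson Min_le finite finite_imageI order.trans rangeI)
        \<comment> \<open>The chain is stopped once \<open>M\<close> exceeds all sides of
          \<open>n\<close>. The number of blocks depends on \<open>n\<close>, but the Cauchy bound
          on their sum does not.\<close>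
        obtain i0 where i0: "Max (range (\<lambda>j. n $ j)) \<le> M i0" using M(2) by blast
        define i where "i = i0"
        have "M i0 \<le> M (Suc (J + i))" using M(1) by (simp add: incseq_def i_def)
        then have nb: "n \<in> index_box (M (Suc (J + i)))"
          using i0 unfolding index_box_def
          by (auto intro: order.trans[OF Max_ge] order.trans)
        have "rect_partial_sum n f x - rect_partial_sum n (fejer_mean (M (J + i)) f) x
            = rect_partial_sum n (r (J + i)) x"
          by (simp add: r_def rect_partial_sum_diff[OF fi integrable_fejer_mean])
        then have "norm (rect_partial_sum n f x - rect_partial_sum n (fejer_mean (M (J + i)) f) x) \<le> V (J + i) x"
          unfolding V_def using nb
          by (auto intro!: add_increasing2 max_partial_sum_nonneg norm_rect_partial_sum_le_max)
        \<comment> \<open>The last remainder costs the term of index \<open>J + i\<close>, one past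
          the telescoped blocks, hence the limit \<open>J + Suc i\<close>. The head is reproduced
          exactly, all sides being at least \<open>M J\<close>.\<close>
        from norm_triangle_le[OF add_mono[OF this tele[of n J i]]]
        have "norm (rect_partial_sum n f x - fejer_mean (M J) f x) \<le> (\<Sum>j=J..<J + Suc i. V j x)"
          by (simp add: rect_partial_sum_fejer_mean[OF nJ])
        also have "\<dots> < e / 2"
          using J1[of J "J + Suc i"] unfolding J_def real_norm_def by linarith
        finally have "norm (rect_partial_sum n f x - fejer_mean (M J) f x) < e / 2" .
        moreover have "norm (fejer_mean (M J) f x - f x) < e / 2"
          using J2[of J] by (simp add: r_def J_def norm_minus_commute)
        ultimately have "norm ((rect_partial_sum n f x - fejer_mean (M J) f x) + (fejer_mean (M J) f x - f x)) < e"
          using norm_triangle_lt[of "rect_partial_sum n f x - fejer_mean (M J) f x" "fejer_mean (M J) f x - f x" e] by linarith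
        then show ?thesis by (simp add: dist_norm)
      qed
      show "\<forall>\<^sub>F n in pringsheim. dist (rect_partial_sum n f x) (f x) < e"
        unfolding pringsheim_def eventually_filtercomap
        by (rule exI[of _ "\<lambda>k. M J \<le> k"]) (auto intro: main eventually_ge_at_top)
    qed
  qed
qed

section \<open>Periodic Borel representatives\<close>

lemma AE_lborel_shift:
  fixes c :: "'a :: euclidean_space"
  assumes "AE x in lborel. P x"
  shows "AE x in lborel. P (x + c)"
proof -
  have "AE x in distr lborel borel ((+) c). P x"
    using assms by (simp only: lborel_distr_plus)
  then have "AE x in lborel. P (c + x)"
    by (rule AE_distrD[rotated]) simp
  then show ?thesis by (simp add: add.commute)
qed

text \<open>The completion yields a Borel function that need not be periodic. Reading it through
  \<open>torus_red\<close> restores periodicity, and the exceptional set is covered by countably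
  many lattice translates of a null set.\<close>

lemma torus_periodic_borel_representative:
  fixes f :: "real ^ 'd \<Rightarrow> complex"
  assumes per: "torus_periodic f" and f: "f \<in> borel_measurable lebesgue"
  obtains g where "g \<in> borel_measurable borel" "torus_periodic g" "AE x in lborel. f x = g x"
proof -
  have "(\<lambda>x. Re (f x)) \<in> borel_measurable lebesgue" "(\<lambda>x. Im (f x)) \<in> borel_measurable lebesgue"
    using f by measurable
  from this[THEN completion_ex_borel_measurable_real]
  obtain u v where [measurable]: "u \<in> borel_measurable lborel" "v \<in> borel_measurable lborel"
    and u: "AE x in lborel. Re (f x) = u x" and v: "AE x in lborel. Im (f x) = v x" by blast
  define g where "g = (\<lambda>x. Complex (u (torus_red x)) (v (torus_red x)))"
  have "AE x in lborel. Re (f x) = u x \<and> Im (f x) = v x"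
    using u v by eventually_elim simp
  then have "AE x in lborel. Re (f (x - lattice_vec k)) = u (x - lattice_vec k)
      \<and> Im (f (x - lattice_vec k)) = v (x - lattice_vec k)" for k
    by (drule_tac AE_lborel_shift[where c = "- lattice_vec k"]) (simp only: diff_conv_add_uminus)
  then have "AE x in lborel. \<forall>k. Re (f (x - lattice_vec k)) = u (x - lattice_vec k)
      \<and> Im (f (x - lattice_vec k)) = v (x - lattice_vec k)"
    by (subst AE_all_countable) blast
  then have "AE x in lborel. f x = g x"
  proof eventually_elim
    case (elim x)
    then have "Re (f (torus_red x)) = u (torus_red x)" "Im (f (torus_red x)) = v (torus_red x)"
      unfolding torus_red_def by blast+
    then show ?case by (simp add: g_def complex_eq_iff torus_periodic_red[OF per])
  qed
  moreover have "g \<in> borel_measurable borel"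
    unfolding g_def Complex_eq by measurable
  moreover have "torus_periodic g"
    unfolding g_def by (rule torus_periodic_comp_red)
  ultimately show ?thesis by (rule that[rotated -1])
qed

lemma AE_torus_measure_of_lborel:
  fixes P :: "real ^ 'd \<Rightarrow> bool"
  assumes "AE x in lborel. P x"
  shows "AE x in torus_measure. P x"
proof (rule AE_torus_measureI)
  show "AE x in torus_borel. P x"
    unfolding torus_borel_def using assms by (subst AE_density) auto
qed

lemma sets_torus_measure [measurable_cong]: "sets torus_measure = sets lebesgue"
  by (simp add: torus_measure_def)

lemma borel_measurable_torus_measure:
  fixes G :: "real ^ 'd \<Rightarrow> 'b :: euclidean_space"
  assumes "G \<in> borel_measurable borel" "AE x in lborel. F x = G x"
  shows "F \<in> borel_measurable torus_measure"
proof -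
  have "F \<in> borel_measurable lebesgue"
  proof (rule borel_measurable_AE)
    show "G \<in> borel_measurable lebesgue" using assms(1) by (simp add: measurable_completion)
    show "AE x in lebesgue. G x = F x"
      using assms(2) by (intro AE_completion) (auto elim: eventually_mono)
  qed
  then show ?thesis by (simp add: measurable_cong_sets[OF sets_torus_measure refl])
qed

lemma integral_torus_measure_AE:
  fixes G :: "real ^ 'd \<Rightarrow> 'b :: euclidean_space"
  assumes "G \<in> borel_measurable borel" "AE x in lborel. F x = G x"
  shows "integral\<^sup>L torus_measure F = integral\<^sup>L torus_borel G"
proof -
  have "integral\<^sup>L torus_measure F = integral\<^sup>L torus_measure G"
    by (intro integral_cong_AE AE_torus_measure_of_lborel assms borel_measurable_torus_measure[OF assms]
        borel_measurable_torus_measure[OF assms(1)]) simp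
  then show ?thesis by (simp add: integral_torus_measure[OF assms(1)])
qed

lemma integrable_torus_borel_of_AE:
  fixes G :: "real ^ 'd \<Rightarrow> real"
  assumes G: "G \<in> borel_measurable borel" and FG: "AE x in lborel. F x = G x"
    and F: "integrable torus_measure F"
  shows "integrable torus_borel G"
proof -
  let ?w = "\<lambda>x :: real ^ 'd. (1 / (2 * pi) ^ CARD('d)) * indicator torus_cube x :: real"
  have w: "(\<lambda>x :: real ^ 'd. ennreal (1 / (2 * pi) ^ CARD('d)) * indicator torus_cube x) = (\<lambda>x. ennreal (?w x))"
    by (auto simp: fun_eq_iff split: split_indicator)
  have m: "G \<in> borel_measurable lebesgue" "?w \<in> borel_measurable lebesgue"
    using G by (auto intro!: measurable_completion)
  have "integrable torus_measure G"
    by (rule integrable_cong_AE_imp[OF F])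
       (use borel_measurable_torus_measure[OF G, of G] AE_torus_measure_of_lborel[OF FG] in auto)
  then have "integrable lebesgue (\<lambda>x. ?w x *\<^sub>R G x)"
    unfolding torus_measure_def w by (subst (asm) integrable_density) (use m in auto)
  then have "integrable lborel (\<lambda>x. ?w x *\<^sub>R G x)"
    by (subst (asm) integrable_completion) (use G in simp_all)
  then show ?thesis
    unfolding torus_borel_def w by (subst integrable_density) (use G in auto)
qed

section \<open>Numerical bounds and summability of the rates\<close>

lemma kernel_const_powr_le:
  assumes "1 \<le> p"
  shows "kernel_const d (2 ^ 2 ^ (j + 3)) powr (1 / p) \<le> (32 * 2 ^ j) powr (real d / p)"
proof -
  \<comment> \<open>Bounding 4 M + 3 by 8 M moves the constants into the exponent. With ln 2 < 1 the
    logarithm is at most 2^(j+3) + 3, hence at most 16 times 2^j; the factor 2 in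
    \<open>kernel_const\<close> gives 32.\<close>
  have "4 * real (2 ^ 2 ^ (j + 3)) + 3 \<le> 2 ^ (2 ^ (j + 3) + 3)"
  proof -
    have "(1::real) \<le> 2 ^ 2 ^ (j + 3)" by (rule one_le_power) simp
    moreover have "(2::real) ^ (2 ^ (j + 3) + 3) = 8 * 2 ^ 2 ^ (j + 3)"
      by (subst power_add) simp
    ultimately show ?thesis by (simp only: of_nat_power of_nat_numeral)
  qed
  then have "ln (4 * real (2 ^ 2 ^ (j + 3)) + 3) \<le> ln (2 ^ (2 ^ (j + 3) + 3))"
    by (rule ln_mono) (simp add: add_pos_pos)
  also have "\<dots> = real (2 ^ (j + 3) + 3) * ln 2"
    by (rule ln_realpow)
  also have "\<dots> \<le> real (2 ^ (j + 3) + 3) * 1"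
    using ln_2_less_1 by (intro mult_left_mono) auto
  also have "\<dots> \<le> 16 * 2 ^ j"
  proof -
    have "(1::real) \<le> 2 ^ j" by (rule one_le_power) simp
    moreover have "real (2 ^ (j + 3) + 3) * 1 = 8 * 2 ^ j + 3" by (simp add: power_add)
    ultimately show ?thesis by linarith
  qed
  finally have "2 * ln (4 * real (2 ^ 2 ^ (j + 3)) + 3) \<le> 32 * 2 ^ j" by simp
  moreover have "0 < 2 * ln (4 * real (2 ^ 2 ^ (j + 3)) + 3)" by (simp add: add_pos_pos)
  ultimately have "(2 * ln (4 * real (2 ^ 2 ^ (j + 3)) + 3)) powr (real d / p) \<le> (32 * 2 ^ j) powr (real d / p)"
    using assms by (intro powr_mono2) auto
  moreover have "kernel_const d (2 ^ 2 ^ (j + 3)) powr (1 / p) = (2 * ln (4 * real (2 ^ 2 ^ (j + 3)) + 3)) powr (real d / p)"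
    using \<open>0 < 2 * ln (4 * real (2 ^ 2 ^ (j + 3)) + 3)\<close>
    unfolding kernel_const_def by (simp only: powr_realpow[symmetric] powr_powr) simp
  ultimately show ?thesis by simp
qed

text \<open>The powers of 2^j cancel. What remains is a power of ln(e + 2^j ln 2), dominated by the
  convergent series of (j + 1)^(-1-\<eta>).\<close>

lemma summable_modulus_weights:
  fixes q \<eta> A :: real
  assumes q: "0 \<le> q" and \<eta>: "0 < \<eta>" and A: "0 \<le> A"
  shows "summable (\<lambda>j. (2 ^ j) powr q *
    (A / ((2 ^ j * ln 2) powr q * ln (exp 1 + 2 ^ j * ln 2) powr (1 + \<eta>))))"
proof (rule summable_comparison_test')
  show "summable (\<lambda>j. A / ln 2 powr q * 4 powr (1 + \<eta>) * real (Suc j) powr (- (1 + \<eta>)))"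
    using \<eta> by (intro summable_mult, subst summable_Suc_iff) (simp add: summable_real_powr_iff)
  fix j :: nat assume "0 \<le> j"
  \<comment> \<open>The divisor 4 covers small \<open>j\<close>, where only the summand e is used;
    afterwards ln 2 \<ge> 1/2 gives the lower bound (j - 1) ln 2.\<close>
  have e: "ln (exp 1 + 2 ^ j * ln 2) \<ge> real (Suc j) / 4"
  proof (cases "j \<le> 3")
    case True
    have "ln (exp 1) \<le> ln (exp 1 + 2 ^ j * ln (2 :: real))"
      by (intro ln_mono) (auto intro: add_pos_pos)
    then have "1 \<le> ln (exp 1 + 2 ^ j * ln (2 :: real))" by simp
    moreover have "real (Suc j) / 4 \<le> 1" using True by simp
    ultimately show ?thesis by linarith
  next
    case False
    have l2: "1 / 2 \<le> ln (2 :: real)" using ln_le_minus_one[of "1 / 2 :: real"] by (simp add: ln_div)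
    have "real (Suc j) / 4 \<le> real (j - 1) * (1 / 2)" using False by simp
    also have "\<dots> \<le> real (j - 1) * ln 2" by (intro mult_left_mono l2) simp
    also have "\<dots> = ln (2 ^ (j - 1))" by (simp add: ln_realpow)
    also have "\<dots> \<le> ln (exp 1 + 2 ^ j * ln 2)"
    proof (intro ln_mono)
      have "(2 :: real) ^ (j - 1) = 2 ^ j * (1 / 2)" using False by (cases j) auto
      also have "\<dots> \<le> 2 ^ j * ln 2" by (intro mult_left_mono l2) simp
      also have "\<dots> \<le> exp 1 + 2 ^ j * ln 2" by simp
      finally show "(2 :: real) ^ (j - 1) \<le> exp 1 + 2 ^ j * ln 2" .
    qed (simp_all add: add_pos_pos)
    finally show ?thesis .
  qed
  have "(2 ^ j) powr q * (A / ((2 ^ j * ln 2) powr q * ln (exp 1 + 2 ^ j * ln 2) powr (1 + \<eta>)))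
      = A / ln 2 powr q * (1 / ln (exp 1 + 2 ^ j * ln 2) powr (1 + \<eta>))"
    by (simp add: powr_mult)
  also have "\<dots> \<le> A / ln 2 powr q * (1 / (real (Suc j) / 4) powr (1 + \<eta>))"
    using e \<eta> A by (intro mult_left_mono divide_left_mono powr_mono2 mult_pos_pos) (auto simp: powr_gt_zero)
  also have "\<dots> = A / ln 2 powr q * 4 powr (1 + \<eta>) * real (Suc j) powr (- (1 + \<eta>))"
    using powr_minus[of "real (Suc j)" "1 + \<eta>"]
    by (simp only: powr_divide[of "real (Suc j)" 4] inverse_eq_divide) simp
  finally show "norm ((2 ^ j) powr q *
      (A / ((2 ^ j * ln 2) powr q * ln (exp 1 + 2 ^ j * ln 2) powr (1 + \<eta>))))
    \<le> A / ln 2 powr q * 4 powr (1 + \<eta>) * real (Suc j) powr (- (1 + \<eta>))"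
    using A by simp
qed

text \<open>With x = 2^j, the exponential 2^x beats every power of x; one surplus power of x leaves
  the geometric factor (1/2)^j.\<close>

lemma summable_double_exponential:
  "summable (\<lambda>j :: nat. (2 ^ j) powr q * (C / 2 ^ 2 ^ j :: real))"
proof -
  have "((\<lambda>x :: real. x powr (q + 1) / 2 powr x) \<longlongrightarrow> 0) at_top" by real_asymp
  moreover have "filterlim (\<lambda>j :: nat. (2 :: real) ^ j) at_top sequentially" by real_asymp
  ultimately have "(\<lambda>j :: nat. ((2 :: real) ^ j) powr (q + 1) / 2 powr (2 ^ j)) \<longlonglongrightarrow> 0"
    by (rule filterlim_compose)
  then have "\<forall>\<^sub>F j in sequentially. ((2 :: real) ^ j) powr (q + 1) / 2 powr (2 ^ j) < 1"
    by (rule order_tendstoD) simp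
  then have "\<forall>\<^sub>F j in sequentially. norm ((2 ^ j) powr q * (1 / 2 ^ 2 ^ j :: real)) \<le> (1 / 2) ^ j"
  proof eventually_elim
    case (elim j)
    have "(2 :: real) powr (2 ^ j) = 2 ^ 2 ^ j"
      using powr_realpow[of 2 "2 ^ j"] by simp
    with elim have "(2 ^ j) powr q * 2 ^ j \<le> (2 ^ 2 ^ j :: real)"
      by (simp add: powr_add)
    then show ?case by (simp add: field_simps power_one_over)
  qed
  then have "summable (\<lambda>j :: nat. (2 ^ j) powr q * (1 / 2 ^ 2 ^ j :: real))"
    by (rule summable_comparison_test_ev) (simp add: summable_geometric)
  from summable_mult[OF this, of C] show ?thesis by (simp add: mult_ac)
qed

text \<open>Each z among x, y satisfies z^p \<le> (x + y)^(p-1) z. The sum of the two merges the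
  modulus error and the kernel tail error, both bounded by p-th powers, into one rate.\<close>

lemma powr_add_ge:
  fixes x y p :: real
  assumes "0 \<le> x" "0 \<le> y" "1 \<le> p"
  shows "x powr p + y powr p \<le> (x + y) powr p"
proof (cases "x + y = 0")
  case False
  then have xy: "0 < x + y" using assms by simp
  have "z powr p \<le> (x + y) powr (p - 1) * z" if "0 \<le> z" "z \<le> x + y" for z
  proof (cases "z = 0")
    case False
    then have "z powr p = z powr (p - 1) * z" using that by (simp add: powr_diff)
    also have "\<dots> \<le> (x + y) powr (p - 1) * z"
      using that assms by (intro mult_right_mono powr_mono2) auto
    finally show ?thesis .
  qed simp
  from add_mono[OF this[of x] this[of y]]
  have "x powr p + y powr p \<le> (x + y) powr (p - 1) * (x + y)"
    using assms by (simp add: distrib_left)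
  then show ?thesis using xy by (simp add: powr_diff)
qed (use assms in \<open>simp add: add_nonneg_eq_0_iff\<close>)

theorem corollary1p3:
  fixes f :: "real ^ 'd \<Rightarrow> complex" and p \<eta> :: real
  assumes "CARD('d) \<ge> 2"
    and "1 \<le> p" and "p \<le> 2"
    and "\<eta> > 0"
    and "f \<in> torus_Lp p"
    and "\<exists>A :: real. \<forall>\<delta>. 0 < \<delta> \<and> \<delta> \<le> 1 / 2 \<longrightarrow>
           modulus_of_continuity p \<delta> f
             \<le> A / (ln (1 / \<delta>) powr (real CARD('d) / p)
                    * ln (ln (exp (exp 1) / \<delta>)) powr (1 + \<eta>))"
  shows "AE x in torus_measure. ((\<lambda>n. rect_partial_sum n f x) \<longlongrightarrow> f x) pringsheim"
proof -
  have p: "1 \<le> p" "p \<le> 2" and \<eta>: "0 < \<eta>" by fact+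
  have per: "torus_periodic f" and fm: "f \<in> borel_measurable lebesgue"
    and fp: "integrable torus_measure (\<lambda>x. norm (f x) powr p)"
    using assms(5) by (auto simp: torus_Lp_def)
  obtain A :: real where A: "\<And>\<delta>. 0 < \<delta> \<Longrightarrow> \<delta> \<le> 1 / 2 \<Longrightarrow>
      modulus_of_continuity p \<delta> f \<le> A / (ln (1 / \<delta>) powr (real CARD('d) / p)
                    * ln (ln (exp (exp 1) / \<delta>)) powr (1 + \<eta>))"
    using assms(6) by blast
  obtain g where gm [measurable]: "g \<in> borel_measurable borel" and gper: "torus_periodic g"
    and fg: "AE x in lborel. f x = g x"
    by (rule torus_periodic_borel_representative[OF per fm])
  have gp: "integrable torus_borel (\<lambda>x. norm (g x) powr p)"
    by (rule integrable_torus_borel_of_AE[OF _ _ fp]) (use fg in \<open>auto elim: eventually_mono\<close>)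
  define I where "I = (\<integral>x. norm (g x) powr p \<partial>torus_borel)"
  have I0: "0 \<le> I" unfolding I_def by simp
  have norm_eq: "Lp_norm p (\<lambda>x. f (x + h) - f x) = (\<integral>x. norm (g (x + h) - g x) powr p \<partial>torus_borel) powr (1 / p)" for h
  proof -
    have "AE x in lborel. norm (f (x + h) - f x) powr p = norm (g (x + h) - g x) powr p"
      using fg AE_lborel_shift[OF fg, of h] by eventually_elim simp
    then show ?thesis
      unfolding Lp_norm_def by (subst integral_torus_measure_AE) auto
  qed
  \<comment> \<open>Only for a bounded set is a supremum of reals known to be an upper bound; this
    supplies the boundedness for \<open>le_modulus\<close>.\<close>
  have norm_le: "Lp_norm p (\<lambda>x. f (x + h) - f x) \<le> (2 powr p * (2 * I)) powr (1 / p)" for h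
    unfolding norm_eq I_def using p
    by (intro powr_mono2 integral_shift_diff_powr_le gper gp) auto
  have le_modulus: "Lp_norm p (\<lambda>x. f (x + h) - f x) \<le> modulus_of_continuity p \<delta> f"
    if "torus_norm h \<le> \<delta>" for h \<delta>
    unfolding modulus_of_continuity_def using that norm_le
    by (intro cSUP_upper bdd_aboveI2[where M = "(2 powr p * (2 * I)) powr (1 / p)"]) auto
  define q where "q = real CARD('d) / p"
  \<comment> \<open>Makes ln(1/\<delta>) equal to 2^j ln 2, doubling from block to block.\<close>
  define \<delta> :: "nat \<Rightarrow> real" where "\<delta> = (\<lambda>j. 1 / 2 ^ 2 ^ j)"
  \<comment> \<open>The fourth power of 1/\<delta>: the kernel tail is of order 1/(M \<delta>^2),
    hence \<delta>^2, which is at most \<delta>^p because p \<le> 2.\<close>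
  define M :: "nat \<Rightarrow> nat" where "M = (\<lambda>j. 2 ^ 2 ^ (j + 2))"
  \<comment> \<open>The hypothesis at \<open>\<delta> j\<close>. The sign of \<open>A\<close> is not
    prescribed; the absolute value keeps \<open>w j\<close> nonnegative, so that p-th powers can be
    compared.\<close>
  define w where "w = (\<lambda>j :: nat. \<bar>A\<bar> / ((2 ^ j * ln 2) powr q * ln (exp 1 + 2 ^ j * ln 2) powr (1 + \<eta>)))"
  \<comment> \<open>Collects the constants of the tail bound; the added 1 gives C \<le> C^p and
    keeps the rates positive when \<open>f\<close> has norm zero.\<close>
  define C where "C = 2 powr p * (2 * I) * (real CARD('d) * pi\<^sup>2) + 1"
  define b where "b = (\<lambda>j :: nat. C / 2 ^ 2 ^ j)"
  have C1: "1 \<le> C" unfolding C_def using I0 by simp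
  have w0: "0 \<le> w j" for j unfolding w_def by simp
  have b0: "0 < b j" for j unfolding b_def using C1 by simp
  have \<delta>: "0 < \<delta> j" "\<delta> j \<le> 1 / 2" for j
  proof -
    have "(2 :: real) ^ 1 \<le> 2 ^ 2 ^ j" by (rule power_increasing) simp_all
    then show "0 < \<delta> j" "\<delta> j \<le> 1 / 2" unfolding \<delta>_def by (simp_all add: field_simps)
  qed
  have small: "(\<integral>x. norm (g (x + h) - g x) powr p \<partial>torus_borel) \<le> w j powr p"
    if h: "torus_norm h \<le> \<delta> j" for h j
  proof -
    let ?J = "\<integral>x. norm (g (x + h) - g x) powr p \<partial>torus_borel"
    have l1: "ln (1 / \<delta> j) = 2 ^ j * ln 2"
      unfolding \<delta>_def by (simp add: ln_realpow)
    have l2: "ln (exp (exp 1) / \<delta> j) = exp 1 + 2 ^ j * ln 2"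
      unfolding \<delta>_def by (simp add: ln_mult_pos ln_realpow)
    have "?J powr (1 / p) \<le> A / ((2 ^ j * ln 2) powr q * ln (exp 1 + 2 ^ j * ln 2) powr (1 + \<eta>))"
      using le_modulus[OF h] A[OF \<delta>[of j]] unfolding norm_eq l1 l2 q_def by linarith
    also have "\<dots> \<le> w j" unfolding w_def by (intro divide_right_mono) auto
    finally have "(?J powr (1 / p)) powr p \<le> w j powr p"
      using p by (intro powr_mono2) auto
    then show ?thesis using p by (simp add: powr_powr)
  qed
  have b_ge: "2 powr p * (2 * I) * (real CARD('d) * (pi\<^sup>2 / (real (M j + 1) * (\<delta> j)\<^sup>2))) \<le> b j powr p" for j
  proof -
    define N :: real where "N = 2 ^ 2 ^ j"
    have N: "1 \<le> N" unfolding N_def by simp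
    have MN: "real (M j) = N ^ 4"
      unfolding M_def N_def by (simp add: power_add flip: power_mult)
    have dN: "\<delta> j = 1 / N" by (simp add: \<delta>_def N_def)
    have "N\<^sup>2 = N ^ 4 * (1 / N)\<^sup>2" using N by (simp add: field_simps eval_nat_numeral)
    also have "\<dots> \<le> real (M j + 1) * (\<delta> j)\<^sup>2"
      unfolding dN by (intro mult_right_mono) (simp_all add: MN)
    finally have "(C - 1) / (real (M j + 1) * (\<delta> j)\<^sup>2) \<le> C / N\<^sup>2"
      using N C1 by (intro frac_le) auto
    also have "\<dots> \<le> C powr p / N powr p"
    proof (rule frac_le)
      show "C \<le> C powr p" using powr_mono[of 1 p C] C1 p by simp
      show "N powr p \<le> N\<^sup>2" using powr_mono[of p 2 N] N p by simp
    qed (use N C1 in auto)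
    also have "\<dots> = b j powr p" using N C1 by (simp add: b_def N_def powr_divide)
    finally show ?thesis by (simp add: C_def mult_ac)
  qed
  define a where "a = (\<lambda>j. w j + b j)"
  have a0: "0 < a j" for j unfolding a_def using w0[of j] b0[of j] by simp
  note approx = fejer_mean_approx[OF gper gm p(1) gp \<delta>(1) powr_ge_zero small]
  have approx_le: "(\<integral>x. norm (g x - fejer_mean (M j) g x) powr p \<partial>torus_borel) \<le> a j powr p" for j
  proof -
    have "(\<integral>x. norm (g x - fejer_mean (M j) g x) powr p \<partial>torus_borel)
        \<le> w j powr p + 2 powr p * (2 * I) * (real CARD('d) * (pi\<^sup>2 / (real (M j + 1) * (\<delta> j)\<^sup>2)))"
      unfolding I_def by (rule approx(2))
    also have "\<dots> \<le> w j powr p + b j powr p" by (intro add_left_mono b_ge)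
    also have "\<dots> \<le> a j powr p"
      unfolding a_def by (rule powr_add_ge) (use w0 b0[of j] p in auto)
    finally show ?thesis .
  qed
  have q0: "0 \<le> q" unfolding q_def using p by simp
  \<comment> \<open>The weight is, up to a constant, the bound of the maximal operator to the power
    1/p, so this one series yields both summability conditions required below.\<close>
  have sum_a: "summable (\<lambda>j. (2 ^ j) powr q * a j)"
    unfolding a_def w_def b_def distrib_left
    by (intro summable_add summable_modulus_weights summable_double_exponential q0 \<eta>) simp
  have "AE x in torus_borel. ((\<lambda>n. rect_partial_sum n g x) \<longlongrightarrow> g x) pringsheim"
  proof (rule AE_pringsheim_of_fejer_mean_bounds[OF gm p gp, where M = M and a = a])
    show "incseq M" unfolding M_def by (intro incseq_SucI power_increasing) auto
    show "\<exists>j. i \<le> M j" for i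
    proof
      have "i + 2 < 2 ^ (i + 2)" "(2::nat) ^ (i + 2) < 2 ^ 2 ^ (i + 2)"
        by (rule less_exp)+
      then have "i \<le> 2 ^ 2 ^ (i + 2)" by linarith
      then show "i \<le> M i" unfolding M_def by simp
    qed
    show "summable a"
    proof (rule summable_comparison_test'[OF sum_a])
      fix j :: nat
      have "1 * a j \<le> (2 ^ j) powr q * a j"
        using a0[of j] q0 by (intro mult_right_mono ge_one_powr_ge_zero) auto
      then show "norm (a j) \<le> (2 ^ j) powr q * a j" using a0[of j] by simp
    qed
    show "summable (\<lambda>j. kernel_const CARD('d) (M (Suc j)) powr (1 / p) * (a j + a (Suc j)))"
    proof (rule summable_comparison_test')
      show "summable (\<lambda>j. 32 powr q * ((2 ^ j) powr q * a j + (2 ^ Suc j) powr q * a (Suc j)))"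
        by (intro summable_mult summable_add sum_a sum_a[THEN summable_Suc_iff[THEN iffD2]])
      fix j :: nat
      have "kernel_const CARD('d) (M (Suc j)) powr (1 / p) \<le> (32 * 2 ^ j) powr q"
        using kernel_const_powr_le[OF p(1), of "CARD('d)" j] by (simp add: M_def q_def eval_nat_numeral)
      then have "kernel_const CARD('d) (M (Suc j)) powr (1 / p) * (a j + a (Suc j))
          \<le> (32 * 2 ^ j) powr q * (a j + a (Suc j))"
        using a0[of j] a0[of "Suc j"] by (intro mult_right_mono) auto
      also have "\<dots> = 32 powr q * ((2 ^ j) powr q * a j + (2 ^ j) powr q * a (Suc j))"
        by (simp add: powr_mult distrib_left)
      also have "\<dots> \<le> 32 powr q * ((2 ^ j) powr q * a j + (2 ^ Suc j) powr q * a (Suc j))"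
        using a0[of "Suc j"] q0 by (intro mult_left_mono add_left_mono mult_right_mono powr_mono2) auto
      finally show "norm (kernel_const CARD('d) (M (Suc j)) powr (1 / p) * (a j + a (Suc j)))
          \<le> 32 powr q * ((2 ^ j) powr q * a j + (2 ^ Suc j) powr q * a (Suc j))"
        using a0[of j] a0[of "Suc j"] by simp
    qed
  qed (use a0 approx(1) approx_le in auto)
  then have "AE x in torus_measure. ((\<lambda>n. rect_partial_sum n g x) \<longlongrightarrow> g x) pringsheim"
    by (rule AE_torus_measureI)
  \<comment> \<open>Coefficients are integrals, so those of \<open>f\<close> and \<open>g\<close>
    agree and the partial sums coincide at every point; only the limit value changes, on a null
    set.\<close>
  moreover have "rect_partial_sum n f = rect_partial_sum n g" for n
  proof -
    have "fourier_coeff f k = fourier_coeff g k" for k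
    proof -
      have e: "exp (- (\<i> * complex_of_real (freq_dot k x))) = cnj (character k x)" for x
        by (simp add: character_def exp_cnj)
      have "AE x in lborel. f x * cnj (character k x) = g x * cnj (character k x)"
        using fg by eventually_elim simp
      then show ?thesis
        unfolding fourier_coeff_eq[OF gm] unfolding fourier_coeff_def e
        by (intro integral_torus_measure_AE) simp_all
    qed
    then show ?thesis by (simp add: fun_eq_iff rect_partial_sum_eq)
  qed
  ultimately show ?thesis
    using AE_torus_measure_of_lborel[OF fg] by (auto elim: eventually_elim2)
qed

end
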